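(* Let $\varphi$ be a piecewise linear but not linear continuous map of the circle $\mathbb T$ into itself. Then $\|e^{in\varphi}\|_{U(\mathbb T)}\simeq \log|n|$, $n\in\mathbb Z$; that is, there exist constants $0<c_1\le c_2<\infty$ and $n_0\ge 2$ (which may depend on $\varphi$) such that for all $n\in\mathbb Z$ with $|n|\ge n_0$, $$c_1\log|n|\;\le\;\|e^{in\varphi}\|_{U(\mathbb T)}\;\le\; c_2\log|n|.$$
   Context: $\mathbb T=\mathbb R/2\pi\mathbb Z$ is the circle. $C(\mathbb T)$ is the space of continuous (complex-valued) functions on $\mathbb T$ with norm $\|f\|_{C(\mathbb T)}=\sup_{t\in\mathbb T}|f(t)|$. For integrable $f$ on $\mathbb T$, $\widehat f(k)=\frac1{2\pi}\int_{\mathbb T}f(t)e^{-ikt}\,dt$ for $k\in\mathbb Z$, and $S_N(f)(t)=\sum_{|k|\le N}\widehat f(k)e^{ikt}$ for $N=0,1,2,\dots$. $U(\mathbb T)$ is the space of all $f\in C(\mathbb T)$ whose Fourier series converges uniformly, i.e. $\|S_N(f)-f\|_{C(\mathbb T)}\to0$ as $N\to\infty$, with norm $\|f\|_{U(\mathbb T)}=\sup_N\|S_N(f)\|_{C(\mathbb T)}$. A continuous map $\varphi$ of $\mathbb T$ into itself means a continuous function $\varphi:\mathbb R\to\mathbb R$ satisfying $\varphi(t+2\pi)=\varphi(t)\ (\mathrm{mod}\ 2\pi)$ for all $t\in\mathbb R$; then $e^{in\varphi}$, i.e. $t\mapsto e^{in\varphi(t)}$, is a well-defined continuous function on $\mathbb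 T$ for each $n\in\mathbb Z$. "Linear" on an interval means of the form $t\mapsto at+b$ with real constants $a,b$; $\varphi$ is linear if it has this form on all of $\mathbb R$. $\varphi$ is piecewise linear if $[0,2\pi]$ is a finite union of intervals such that $\varphi$ is linear on each of them. *)

theory Defs
  imports "HOL-Analysis.Analysis" "HOL-Library.Real_Mod"
begin

text \<open>
  Functions on the circle \<open>\<real>/2\<pi>\<int>\<close> are represented by \<open>2\<pi>\<close>-periodic functions on the real line.
\<close>

definition circle_C :: "(real \<Rightarrow> complex) set" where
  "circle_C = {f. continuous_on UNIV f \<and> (\<forall>t. f (t + 2 * pi) = f t)}"

text \<open>
  The suprema below are taken in the reals, so they are meaningful only for bounded families:
  \<open>C_norm\<close> is used for elements of \<open>circle_C\<close>, and \<open>U_norm\<close> for elements of \<open>circle_U\<close>.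
\<close>

definition C_norm :: "(real \<Rightarrow> complex) \<Rightarrow> real" where
  "C_norm f = (SUP t. norm (f t))"

definition fourier_coeff :: "(real \<Rightarrow> complex) \<Rightarrow> int \<Rightarrow> complex" where
  "fourier_coeff f k =
     1 / (2 * pi) * (LBINT t:{0..2*pi}. f t * exp (- \<i> * of_int k * of_real t))"

definition fourier_sum :: "nat \<Rightarrow> (real \<Rightarrow> complex) \<Rightarrow> real \<Rightarrow> complex" where
  "fourier_sum N f t =
     (\<Sum>k\<in>{-int N..int N}. fourier_coeff f k * exp (\<i> * of_int k * of_real t))"

definition circle_U :: "(real \<Rightarrow> complex) set" where
  "circle_U = {f \<in> circle_C. (\<lambda>N. C_norm (\<lambda>t. fourier_sum N f t - f t)) \<longlonglongrightarrow> 0}"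

definition U_norm :: "(real \<Rightarrow> complex) \<Rightarrow> real" where
  "U_norm f = (SUP N. C_norm (fourier_sum N f))"

definition circle_map :: "(real \<Rightarrow> real) \<Rightarrow> bool" where
  "circle_map \<phi> \<longleftrightarrow>
     continuous_on UNIV \<phi> \<and> (\<forall>t. [\<phi> (t + 2 * pi) = \<phi> t] (rmod (2 * pi)))"

text \<open>Linearity is in the affine sense, unlike the library's \<open>linear\<close>.\<close>

definition affine_linear_on :: "real set \<Rightarrow> (real \<Rightarrow> real) \<Rightarrow> bool" where
  "affine_linear_on I \<phi> \<longleftrightarrow> (\<exists>a b. \<forall>t\<in>I. \<phi> t = a * t + b)"

definition piecewise_linear :: "(real \<Rightarrow> real) \<Rightarrow> bool" where
  "piecewise_linear \<phi> \<longleftrightarrow>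
     (\<exists>\<I>. finite \<I> \<and> \<Union>\<I> = {0..2*pi} \<and> (\<forall>I\<in>\<I>. is_interval I \<and> affine_linear_on I \<phi>))"

end

theory Submission
  imports Defs
begin

text \<open>
  Write \<open>f = e\<^sup>i\<^sup>n\<^sup>\<phi>\<close>, let \<open>D\<^sub>N\<close> be the Dirichlet kernel, and use
  \<open>2\<pi> S\<^sub>N f(t) = \<integral>\<^sub>0\<^sup>\<pi> (f(t+s) + f(t-s)) D\<^sub>N(s) ds\<close>
  (\<open>fourier_sum_eq_integral\<close>) together with \<open>\<bar>D\<^sub>N(s)\<bar> \<le> \<pi>/s\<close>.

  Upper bound. A piecewise linear \<open>\<phi>\<close> is Lipschitz, with constant \<open>A\<close> say, so \<open>f\<close> is
  \<open>\<bar>n\<bar>A\<close>-Lipschitz. On \<open>[0, 1/\<bar>n\<bar>]\<close> the Lipschitz bound cancels the singularity of the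
  kernel and the contribution of \<open>f(t+s) + f(t-s) - 2f(t)\<close> is bounded; on \<open>[1/\<bar>n\<bar>, \<pi>]\<close> the trivial bound on \<open>f\<close> leaves
  \<open>\<integral> ds/s = ln(\<pi>\<bar>n\<bar>)\<close> (\<open>norm_fourier_sum_minus_le\<close>). Uniform convergence for each
  fixed \<open>n\<close> is the same splitting, with the Riemann--Lebesgue decay of
  \<open>\<integral> q(s) sin(Ms) ds\<close> for Lipschitz \<open>q\<close> used away from \<open>0\<close>
  (\<open>lipschitz_in_circle_U\<close>).

  Lower bound. Since \<open>\<phi>\<close> is not affine it has a corner \<open>t\<^sub>0\<close> on the circle (\<open>exists_corner\<close>):
  \<open>\<phi>(t\<^sub>0+s) = \<phi>(t\<^sub>0) + \<beta>s\<close> and \<open>\<phi>(t\<^sub>0-s) = \<phi>(t\<^sub>0) + \<gamma>s\<close> for small \<open>s \<ge> 0\<close>,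
  with \<open>\<beta> + \<gamma> \<noteq> 0\<close>. Up to a unimodular factor and bounded terms, \<open>2\<pi> S\<^sub>N f(t\<^sub>0)\<close> has
  imaginary part \<open>\<integral> (sin n\<beta>s + sin n\<gamma>s) sin(Ms)/sin(s/2) ds\<close> with \<open>M = N + 1/2\<close>. When
  \<open>M\<close> is tuned to the larger of \<open>\<bar>n\<beta>\<bar>, \<bar>n\<gamma>\<bar>\<close>, the product formula
  produces a resonant term \<open>cos(\<omega>s)\<close> with \<open>\<bar>\<omega>\<bar> \<le> 1/2\<close>, which
  integrates to at least \<open>ln(\<delta>\<bar>n\<bar>)\<close>; the other frequencies are of order \<open>\<bar>n\<bar>\<close> and
  contribute \<open>O(1)\<close> after an integration by parts, apart from a second resonance of the same sign when
  \<open>\<beta> = \<gamma>\<close>. The case \<open>\<beta> + \<gamma> = 0\<close>, no corner,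
  is exactly the one in which the resonances of the two sides cancel (\<open>dirichlet_integral_ge\<close>).
\<close>

section \<open>The Dirichlet kernel\<close>

text \<open>
  The real cosine form is continuous at \<open>0\<close>, where the quotient
  \<open>sin((N + 1/2)s) / sin(s/2)\<close> takes the default value \<open>0\<close>.
\<close>

definition dirichlet_kernel :: "nat \<Rightarrow> real \<Rightarrow> real" where
  "dirichlet_kernel N s = 1 + 2 * (\<Sum>k=1..N. cos (real k * s))"

lemma dirichlet_kernel_minus [simp]: "dirichlet_kernel N (- s) = dirichlet_kernel N s"
  by (simp add: dirichlet_kernel_def)

lemma continuous_on_dirichlet_kernel [continuous_intros]:
  fixes A :: "real set"
  assumes "continuous_on A g"
  shows "continuous_on A (\<lambda>x. dirichlet_kernel N (g x))"
  unfolding dirichlet_kernel_def by (intro continuous_intros assms)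

lemma dirichlet_kernel_periodic: "dirichlet_kernel N (s + 2 * pi) = dirichlet_kernel N s"
proof -
  have "cos (real k * (s + 2 * pi)) = cos (real k * s)" for k
    using cos.plus_of_nat[of "real k * s" k] by (simp add: algebra_simps)
  then show ?thesis by (simp add: dirichlet_kernel_def)
qed

lemma sum_exp_eq_dirichlet_kernel:
  "(\<Sum>k\<in>{-int N..int N}. exp (\<i> * of_int k * of_real x)) = of_real (dirichlet_kernel N x)"
proof (induction N)
  case 0
  then show ?case by (simp add: dirichlet_kernel_def)
next
  case (Suc N)
  have *: "{-int (Suc N)..int (Suc N)} = insert (int (Suc N)) (insert (-int (Suc N)) {-int N..int N})"
    by auto
  have "exp (\<i> * of_int (int (Suc N)) * of_real x) + exp (\<i> * of_int (- int (Suc N)) * of_real x)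
      = of_real (2 * cos (real (Suc N) * x))"
    by (simp add: cos_exp_eq cos_of_real[symmetric] algebra_simps)
  then show ?case
    unfolding * using Suc by (simp add: dirichlet_kernel_def algebra_simps)
qed

lemma dirichlet_kernel_mult_sin:
  "dirichlet_kernel N s * sin (s / 2) = sin ((real N + 1/2) * s)"
proof (induction N)
  case 0
  then show ?case by (simp add: dirichlet_kernel_def)
next
  case (Suc N)
  have "sin ((real (Suc N) + 1/2) * s) - sin ((real N + 1/2) * s) = 2 * cos (real (Suc N) * s) * sin (s / 2)"
    using sin_add[of "real (Suc N) * s" "s/2"] sin_diff[of "real (Suc N) * s" "s/2"]
    by (simp add: algebra_simps)
  then show ?case using Suc by (simp add: dirichlet_kernel_def algebra_simps)
qed

text \<open>
  Concavity of the sine on \<open>[0, \<pi>]\<close> puts its graph above the chord from \<open>0\<close> to \<open>\<pi>/2\<close>.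
\<close>

lemma sin_half_lower:
  fixes s :: real
  assumes "0 \<le> s" "s \<le> pi"
  shows "s / pi \<le> sin (s / 2)"
proof -
  have conc: "concave_on {0..pi} (sin :: real \<Rightarrow> real)"
  proof (rule f''_le0_imp_concave)
    show "((\<lambda>x. sin x) has_real_derivative cos x) (at x)" for x :: real
      by (auto intro!: derivative_eq_intros)
    show "(cos has_real_derivative - sin x) (at x)" for x :: real
      by (auto intro!: derivative_eq_intros)
  qed (auto intro: sin_ge_zero)
  have "sin ((1 - s/pi) *\<^sub>R 0 + (s/pi) *\<^sub>R (pi/2)) \<ge> (1 - s/pi) * sin 0 + (s/pi) * sin (pi/2)"
    using assms by (intro concave_onD[OF conc]) auto
  then show ?thesis by simp
qed

lemma sin_half_pos:
  fixes s :: real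
  assumes "0 < s" "s \<le> pi"
  shows "0 < sin (s / 2)"
  using assms by (intro sin_gt_zero) auto

lemma inverse_sin_half_le:
  fixes s :: real
  assumes "0 < s" "s \<le> pi"
  shows "1 / sin (s / 2) \<le> pi / s"
  using sin_half_lower[of s] sin_half_pos[of s] assms by (simp add: field_simps)

lemma dirichlet_kernel_eq:
  assumes "0 < s" "s \<le> pi"
  shows "dirichlet_kernel N s = sin ((real N + 1/2) * s) / sin (s / 2)"
  using dirichlet_kernel_mult_sin[of N s] sin_half_pos[OF assms] by (simp add: field_simps)

lemma abs_dirichlet_kernel_le:
  assumes "0 < s" "s \<le> pi"
  shows "\<bar>dirichlet_kernel N s\<bar> \<le> pi / s"
proof -
  have "\<bar>dirichlet_kernel N s\<bar> = \<bar>sin ((real N + 1/2) * s)\<bar> * (1 / sin (s / 2))"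
    using sin_half_pos[OF assms] by (simp add: dirichlet_kernel_eq[OF assms] abs_mult)
  also have "\<dots> \<le> 1 * (pi / s)"
    using inverse_sin_half_le[OF assms] sin_half_pos[OF assms] by (intro mult_mono) auto
  finally show ?thesis by simp
qed

lemma integral_dirichlet_kernel: "(dirichlet_kernel N has_integral pi) {0..pi}"
proof -
  let ?F = "\<lambda>s. s + 2 * (\<Sum>k=1..N. sin (real k * s) / real k)"
  have "(dirichlet_kernel N has_integral (?F pi - ?F 0)) {0..pi}"
  proof (rule fundamental_theorem_of_calculus)
    fix x :: real
    have "((\<lambda>s. s + 2 * (\<Sum>k=1..N. sin (real k * s) / real k)) has_real_derivative dirichlet_kernel N x) (at x within {0..pi})"
      unfolding dirichlet_kernel_def
      by (auto intro!: derivative_eq_intros DERIV_sum sum.cong)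
    then show "(?F has_vector_derivative dirichlet_kernel N x) (at x within {0..pi})"
      by (simp add: has_real_derivative_iff_has_vector_derivative)
  qed simp
  moreover have "sin (real k * pi) = 0" for k by (simp add: sin_zero_iff_int2)
  ultimately show ?thesis by simp
qed

lemma integral_periodic_shift:
  fixes g :: "real \<Rightarrow> 'a :: euclidean_space"
  assumes cont: "continuous_on UNIV g" and per: "\<And>t. g (t + p) = g t" and p: "p > 0"
  shows "integral {a..a + p} g = integral {0..p} g"
proof -
  interpret periodic_fun_simple g p by standard (rule per)
  have int: "g integrable_on {x..y}" for x y
    by (rule integrable_continuous_real) (rule continuous_on_subset[OF cont], simp)
  \<comment> \<open>The representative of \<open>a\<close> in \<open>[0, p]\<close>, so that the window meets only one multiple of \<open>p\<close>.\<close>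
  define b where "b = a - of_int \<lfloor>a / p\<rfloor> * p"
  have b: "0 \<le> b" "b \<le> p"
    using p floor_divide_lower[of p a] floor_divide_upper[of p a] by (auto simp: b_def algebra_simps)
  have shift: "integral {x..y} g = integral {x + of_int k * p..y + of_int k * p} g" for x y k
  proof -
    have "g \<circ> (+) (of_int k * p) = g"
      by (auto simp: fun_eq_iff plus_of_int add.commute)
    then show ?thesis using integral_shift_Icc_real[of x y g "of_int k * p"] by simp
  qed
  have "integral {a..a + p} g = integral {b..b + p} g"
    using shift[of b "b + p" "\<lfloor>a / p\<rfloor>"] by (simp add: b_def algebra_simps)
  also have "\<dots> = integral {b..p} g + integral {p..b + p} g"
    using b p by (intro Henstock_Kurzweil_Integration.integral_combine[symmetric] int) auto
  also have "integral {p..b + p} g = integral {0..b} g"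
    using shift[of 0 b 1] by simp
  also have "integral {b..p} g + integral {0..b} g = integral {0..p} g"
    using b Henstock_Kurzweil_Integration.integral_combine[of 0 b p g] int by (simp add: add.commute)
  finally show ?thesis .
qed

text \<open>
  Summing the coefficient integrals gives the convolution of \<open>f\<close> with the kernel. Periodicity moves the
  window of integration to \<open>[t-\<pi>, t+\<pi>]\<close>, and folding it about \<open>t\<close> leaves an integral over
  \<open>[0, \<pi>]\<close>, where the singularity sits at one endpoint.
\<close>

lemma fourier_sum_eq_integral:
  fixes f :: "real \<Rightarrow> complex"
  assumes f: "f \<in> circle_C"
  shows "fourier_sum N f t =
    1 / (2 * pi) * integral {0..pi} (\<lambda>s. (f (t + s) + f (t - s)) * of_real (dirichlet_kernel N s))"
proof -
  have cont: "continuous_on A f" for A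
    using f continuous_on_subset[of UNIV f A] by (auto simp: circle_C_def)
  have contc [continuous_intros]: "continuous_on A (\<lambda>x. f (g x))" if "continuous_on A g" for A and g :: "real \<Rightarrow> real"
    by (rule continuous_on_compose2[OF cont[of UNIV] that]) auto
  have coeff: "fourier_coeff f k * exp (\<i> * of_int k * of_real t) =
      1 / (2 * pi) * integral {0..2*pi} (\<lambda>u. f u * exp (\<i> * of_int k * of_real (t - u)))" for k
  proof -
    have "continuous_on {0..2*pi} (\<lambda>t. f t * exp (- \<i> * of_int k * of_real t))"
      by (intro continuous_intros cont)
    then have "(LBINT t:{0..2*pi}. f t * exp (- \<i> * of_int k * of_real t))
        = integral {0..2*pi} (\<lambda>t. f t * exp (- \<i> * of_int k * of_real t))"
      by (intro set_borel_integral_eq_integral borel_integrable_atLeastAtMost')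
    then have "fourier_coeff f k * exp (\<i> * of_int k * of_real t) = 1 / (2 * pi) * 
       integral {0..2*pi} (\<lambda>u. f u * exp (- \<i> * of_int k * of_real u) * exp (\<i> * of_int k * of_real t))"
      unfolding fourier_coeff_def by (simp only: Henstock_Kurzweil_Integration.integral_mult_left) (simp only: mult.assoc)
    also have "(\<lambda>u. f u * exp (- \<i> * of_int k * of_real u) * exp (\<i> * of_int k * of_real t)) 
       = (\<lambda>u. f u * exp (\<i> * of_int k * of_real (t - u)))"
      by (auto simp: fun_eq_iff exp_add[symmetric] algebra_simps)
    finally show ?thesis .
  qed
  define g where "g u = f u * of_real (dirichlet_kernel N (t - u))" for u
  have g_cont: "continuous_on A g" for A
    unfolding g_def by (intro continuous_intros)
  have int: "g integrable_on {x..y}" for x y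
    by (intro integrable_continuous_real g_cont)
  have g_per: "g (u + 2 * pi) = g u" for u
  proof -
    have "dirichlet_kernel N (t - (u + 2 * pi)) = dirichlet_kernel N (t - u)"
      using dirichlet_kernel_periodic[of N "t - (u + 2 * pi)"] by (simp add: algebra_simps)
    then show ?thesis using f by (simp add: g_def circle_C_def)
  qed
  have "fourier_sum N f t = (\<Sum>k\<in>{-int N..int N}. 1 / (2 * pi) * integral {0..2*pi} (\<lambda>u. f u * exp (\<i> * of_int k * of_real (t - u))))"
    unfolding fourier_sum_def by (simp only: coeff)
  also have "\<dots> = 1 / (2 * pi) * integral {0..2*pi} (\<lambda>u. \<Sum>k\<in>{-int N..int N}. f u * exp (\<i> * of_int k * of_real (t - u)))"
    by (subst integral_sum) (auto intro!: integrable_continuous_real continuous_intros simp: sum_distrib_left)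
  also have "(\<lambda>u. \<Sum>k\<in>{-int N..int N}. f u * exp (\<i> * of_int k * of_real (t - u))) = g"
    unfolding g_def sum_exp_eq_dirichlet_kernel[symmetric] by (simp add: sum_distrib_left)
  also have "integral {0..2*pi} g = integral {t - pi..t - pi + 2 * pi} g"
    by (rule integral_periodic_shift[symmetric, OF g_cont g_per]) simp
  also have "\<dots> = integral {-pi + t..0 + t} g + integral {0 + t..pi + t} g"
    using Henstock_Kurzweil_Integration.integral_combine[of "t - pi" t "t + pi" g] int by (simp add: algebra_simps)
  also have "integral {-pi + t..0 + t} g = integral {-pi..-0} (\<lambda>s. g (t + s))"
    using integral_shift_Icc_real[of "-pi" 0 g t] by (simp add: o_def)
  also have "\<dots> = integral {0..pi} (\<lambda>s. g (t - s))"
    using Henstock_Kurzweil_Integration.integral_reflect_real[of pi 0 "\<lambda>s. g (t - s)"] by simp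
  also have "integral {0 + t..pi + t} g = integral {0..pi} (\<lambda>s. g (t + s))"
    using integral_shift_Icc_real[of 0 "pi" g t] by (simp add: o_def)
  also have "integral {0..pi} (\<lambda>s. g (t - s)) + integral {0..pi} (\<lambda>s. g (t + s)) 
     = integral {0..pi} (\<lambda>s. g (t - s) + g (t + s))"
    by (intro integral_add[symmetric] integrable_continuous_real continuous_on_compose2[OF g_cont[of UNIV]]
       continuous_intros) auto
  also have "(\<lambda>s. g (t - s) + g (t + s)) = (\<lambda>s. (f (t + s) + f (t - s)) * of_real (dirichlet_kernel N s))"
    by (simp add: g_def fun_eq_iff algebra_simps)
  finally show ?thesis .
qed

lemma circle_C_continuous_on:
  fixes f :: "real \<Rightarrow> complex"
  assumes "f \<in> circle_C" "continuous_on A g"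
  shows "continuous_on A (\<lambda>x. f (g x))"
  using assms by (intro continuous_on_compose2[of UNIV f A g]) (auto simp: circle_C_def)

text \<open>
  Because the kernel integrates to \<open>\<pi>\<close>, subtracting \<open>f t\<close> turns the symmetric sum
  into the second difference of \<open>f\<close>, which vanishes at \<open>s = 0\<close>.
\<close>

lemma fourier_sum_minus_eq_integral:
  fixes f :: "real \<Rightarrow> complex"
  assumes f: "f \<in> circle_C"
  shows "fourier_sum N f t - f t =
    1 / (2 * pi) * integral {0..pi} (\<lambda>s. (f (t + s) + f (t - s) - 2 * f t) * of_real (dirichlet_kernel N s))"
proof -
  have "((\<lambda>s. complex_of_real (dirichlet_kernel N s)) has_integral complex_of_real pi) {0..pi}"
    by (intro has_integral_of_real integral_dirichlet_kernel)
  then have "((\<lambda>s. 2 * f t * complex_of_real (dirichlet_kernel N s)) has_integral 2 * f t * complex_of_real pi) {0..pi}"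
    by (rule has_integral_mult_right)
  then have 1: "integral {0..pi} (\<lambda>s. 2 * f t * of_real (dirichlet_kernel N s)) = 2 * f t * of_real pi"
    by (rule integral_unique)
  have "integral {0..pi} (\<lambda>s. (f (t + s) + f (t - s)) * of_real (dirichlet_kernel N s) - 2 * f t * of_real (dirichlet_kernel N s))
    = integral {0..pi} (\<lambda>s. (f (t + s) + f (t - s)) * of_real (dirichlet_kernel N s)) - integral {0..pi} (\<lambda>s. 2 * f t * of_real (dirichlet_kernel N s))"
    by (intro Henstock_Kurzweil_Integration.integral_diff integrable_continuous_real continuous_intros circle_C_continuous_on[OF f])
  then show ?thesis
    unfolding fourier_sum_eq_integral[OF f] 1 left_diff_distrib by (simp add: field_simps)
qed

section \<open>Partial sums of Lipschitz functions\<close>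

lemma has_integral_const_div:
  fixes c :: real
  assumes "0 < a" "a \<le> b"
  shows "((\<lambda>s. c / s) has_integral c * ln (b / a)) {a..b}"
proof -
  have "((\<lambda>s. c / s) has_integral (c * ln b - c * ln a)) {a..b}"
  proof (rule fundamental_theorem_of_calculus)
    fix x assume "x \<in> {a..b}"
    then have "((\<lambda>s. c * ln s) has_real_derivative c / x) (at x within {a..b})"
      using assms by (auto intro!: derivative_eq_intros)
    then show "((\<lambda>s. c * ln s) has_vector_derivative c / x) (at x within {a..b})"
      by (simp add: has_real_derivative_iff_has_vector_derivative)
  qed (use assms in auto)
  then show ?thesis using assms by (simp add: ln_div algebra_simps)
qed

lemma norm_second_difference_le:
  fixes f :: "real \<Rightarrow> complex"
  assumes "L-lipschitz_on UNIV f" "0 \<le> s"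
  shows "norm (f (t + s) + f (t - s) - 2 * f t) \<le> 2 * L * s"
proof -
  have "norm (f (t + s) - f t) \<le> L * s" "norm (f (t - s) - f t) \<le> L * s"
    using lipschitz_onD[OF assms(1), of "t + s" t] lipschitz_onD[OF assms(1), of "t - s" t] assms(2)
    by (auto simp: dist_norm)
  then show ?thesis
    using norm_triangle_ineq[of "f (t + s) - f t" "f (t - s) - f t"] by (simp add: algebra_simps)
qed

lemma norm_second_difference_le_4:
  fixes f :: "real \<Rightarrow> complex"
  assumes "\<And>t. norm (f t) \<le> 1"
  shows "norm (f (t + s) + f (t - s) - 2 * f t) \<le> 4"
proof -
  have "norm (f (t + s) + f (t - s) - 2 * f t) \<le> norm (f (t + s)) + norm (f (t - s)) + norm (2 * f t)"
    by (meson norm_triangle_ineq norm_triangle_ineq4 order_trans add_right_mono)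
  then show ?thesis using assms[of "t + s"] assms[of "t - s"] assms[of t] by (simp add: norm_mult)
qed

text \<open>
  The factor \<open>s\<close> gained from the Lipschitz bound cancels the \<open>1/s\<close> of the kernel.
\<close>

lemma norm_integral_near_zero_le:
  fixes f :: "real \<Rightarrow> complex"
  assumes f: "f \<in> circle_C" and L: "L-lipschitz_on UNIV f" and \<eta>: "0 \<le> \<eta>" "\<eta> \<le> pi"
  shows "norm (integral {0..\<eta>} (\<lambda>s. (f (t + s) + f (t - s) - 2 * f t) * of_real (dirichlet_kernel N s)))
    \<le> 2 * pi * L * \<eta>"
proof -
  have "norm ((f (t + s) + f (t - s) - 2 * f t) * of_real (dirichlet_kernel N s)) \<le> 2 * pi * L"
    if s: "s \<in> {0..\<eta>}" for s
  proof (cases "s = 0")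
    case True
    then show ?thesis using lipschitz_on_nonneg[OF L] by simp
  next
    case False
    then have s': "0 < s" "s \<le> pi" using s \<eta> by auto
    have "norm ((f (t + s) + f (t - s) - 2 * f t) * of_real (dirichlet_kernel N s)) \<le> (2 * L * s) * (pi / s)"
      unfolding norm_mult using s' norm_second_difference_le[OF L, of s t] abs_dirichlet_kernel_le[OF s', of N]
      by (intro mult_mono) (auto simp: lipschitz_on_nonneg[OF L])
    also have "(2 * L * s) * (pi / s) = 2 * pi * L" using s' by simp
    finally show ?thesis .
  qed
  then have "norm (integral {0..\<eta>} (\<lambda>s. (f (t + s) + f (t - s) - 2 * f t) * of_real (dirichlet_kernel N s)))
    \<le> 2 * pi * L * (\<eta> - 0)"
    using \<eta> by (intro integral_bound continuous_intros circle_C_continuous_on[OF f]) auto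
  then show ?thesis by simp
qed

lemma fourier_sum_minus_split:
  fixes f :: "real \<Rightarrow> complex"
  assumes f: "f \<in> circle_C" and \<eta>: "0 \<le> \<eta>" "\<eta> \<le> pi"
  shows "fourier_sum N f t - f t = 1 / (2 * pi) * 
    (integral {0..\<eta>} (\<lambda>s. (f (t + s) + f (t - s) - 2 * f t) * of_real (dirichlet_kernel N s)) +
     integral {\<eta>..pi} (\<lambda>s. (f (t + s) + f (t - s) - 2 * f t) * of_real (dirichlet_kernel N s)))"
  unfolding fourier_sum_minus_eq_integral[OF f]
  using \<eta> by (subst Henstock_Kurzweil_Integration.integral_combine)
    (auto intro!: integrable_continuous_real continuous_intros circle_C_continuous_on[OF f])

text \<open>
  For \<open>L = A\<bar>n\<bar>\<close> the choice \<open>\<eta> = 1/\<bar>n\<bar>\<close> balances the two terms: the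
  first is then constant and the second logarithmic.
\<close>

lemma norm_fourier_sum_minus_le:
  fixes f :: "real \<Rightarrow> complex"
  assumes f: "f \<in> circle_C" and L: "L-lipschitz_on UNIV f" and bd: "\<And>t. norm (f t) \<le> 1"
    and \<eta>: "0 < \<eta>" "\<eta> \<le> pi"
  shows "norm (fourier_sum N f t - f t) \<le> L * \<eta> + 2 * ln (pi / \<eta>)"
proof -
  define g where "g s = (f (t + s) + f (t - s) - 2 * f t) * of_real (dirichlet_kernel N s)" for s
  have "norm (integral {\<eta>..pi} g) \<le> integral {\<eta>..pi} (\<lambda>s. 4 * pi / s)"
  proof (rule Henstock_Kurzweil_Integration.integral_norm_bound_integral)
    show "g integrable_on {\<eta>..pi}"
      unfolding g_def by (intro integrable_continuous_real continuous_intros circle_C_continuous_on[OF f])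
    show "(\<lambda>s. 4 * pi / s) integrable_on {\<eta>..pi}"
      using has_integral_const_div[OF \<eta>] by blast
    fix s assume "s \<in> {\<eta>..pi}"
    then have s: "0 < s" "s \<le> pi" using \<eta> by auto
    have "norm (g s) \<le> 4 * (pi / s)"
      unfolding norm_mult g_def using norm_second_difference_le_4[of f t s, OF bd] abs_dirichlet_kernel_le[OF s, of N]
      by (intro mult_mono) auto
    then show "norm (g s) \<le> 4 * pi / s" by simp
  qed
  also have "\<dots> = 4 * pi * ln (pi / \<eta>)"
    by (intro integral_unique has_integral_const_div \<eta>)
  finally have far: "norm (integral {\<eta>..pi} g) \<le> 4 * pi * ln (pi / \<eta>)" .
  have near: "norm (integral {0..\<eta>} g) \<le> 2 * pi * L * \<eta>"
    unfolding g_def using norm_integral_near_zero_le[OF f L] \<eta> by auto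
  have "norm (fourier_sum N f t - f t) = 1 / (2 * pi) * norm (integral {0..\<eta>} g + integral {\<eta>..pi} g)"
    using fourier_sum_minus_split[OF f, of \<eta> N t] \<eta> by (simp add: norm_mult norm_divide g_def[abs_def])
  also have "\<dots> \<le> 1 / (2 * pi) * (2 * pi * L * \<eta> + 4 * pi * ln (pi / \<eta>))"
    using near far norm_triangle_ineq[of "integral {0..\<eta>} g" "integral {\<eta>..pi} g"]
    by (intro mult_left_mono) auto
  also have "\<dots> = L * \<eta> + 2 * ln (pi / \<eta>)"
    by (simp add: field_simps)
  finally show ?thesis .
qed

text \<open>
  A quantitative Riemann--Lebesgue lemma. Translating by the half period \<open>w = \<pi>/M\<close> changes the
  sign of \<open>sin(Ms)\<close>, so twice the integral is the integral of \<open>(q(s) - q(s+w)) sin(Ms)\<close>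
  plus two end pieces of length \<open>w\<close>; each of these is \<open>O(1/M)\<close>. In contrast to an integration by
  parts, this does not differentiate \<open>q\<close>.
\<close>

lemma norm_integral_mult_sin_le:
  fixes q :: "real \<Rightarrow> complex"
  assumes ab: "a \<le> b" and q: "Q-lipschitz_on {a..b} q" and B: "\<And>s. s \<in> {a..b} \<Longrightarrow> norm (q s) \<le> B"
    and M: "M > 0"
  shows "norm (integral {a..b} (\<lambda>s. q s * of_real (sin (M * s)))) \<le> (Q * (b - a) + 2 * B) * pi / (2 * M)"
proof -
  \<comment> \<open>Extends \<open>q\<close> by constants beyond \<open>[a, b]\<close>, so that translates make sense and keep its bounds.\<close>
  define r where "r s = q (max a (min b s))" for s
  define w where "w = pi / M"
  define G where "G s = r s * of_real (sin (M * s))" for s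
  have w: "w > 0" using M by (simp add: w_def)
  have r_lip: "norm (r s - r s') \<le> Q * \<bar>s - s'\<bar>" for s s'
  proof -
    have "norm (r s - r s') \<le> Q * \<bar>max a (min b s) - max a (min b s')\<bar>"
      using lipschitz_onD[OF q, of "max a (min b s)" "max a (min b s')"] ab
      by (auto simp: r_def dist_norm)
    also have "\<dots> \<le> Q * \<bar>s - s'\<bar>"
      by (intro mult_left_mono lipschitz_on_nonneg[OF q]) (auto simp: max_def min_def)
    finally show ?thesis .
  qed
  have "Q-lipschitz_on UNIV r"
    by (intro lipschitz_onI) (auto simp: r_lip dist_norm lipschitz_on_nonneg[OF q])
  then have "continuous_on UNIV r" by (rule lipschitz_on_continuous_on)
  then have [continuous_intros]: "continuous_on A (\<lambda>x. r (g x))" if "continuous_on A g" for A and g :: "real \<Rightarrow> real"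
    using that by (rule continuous_on_compose2) auto
  have r_bd: "norm (r s) \<le> B" for s
    unfolding r_def using ab by (intro B) auto
  have G_bd: "norm (G s) \<le> B" for s
    using mult_mono[of "norm (r s)" B "\<bar>sin (M * s)\<bar>" 1] r_bd[of s] order_trans[OF norm_ge_zero r_bd]
    by (simp add: G_def norm_mult)
  have G_cont: "continuous_on A G" for A
    unfolding G_def by (intro continuous_intros)
  have G_int: "G integrable_on {x..y}" for x y
    by (intro integrable_continuous_real G_cont)
  have short: "norm (integral {x..x + w} G) \<le> B * w" for x
    using integral_bound[of x "x + w" G B] w G_bd G_cont by auto
  have "integral {a..b} (\<lambda>s. r (s + w) * of_real (sin (M * s))) = - integral {a..b} (\<lambda>s. G (w + s))"
  proof -
    have "sin (M * (w + s)) = - sin (M * s)" for s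
      using M by (simp add: w_def distrib_left sin_add)
    then have "(\<lambda>s. r (s + w) * of_real (sin (M * s))) = (\<lambda>s. - G (w + s))"
      by (simp add: G_def fun_eq_iff add.commute)
    then show ?thesis by simp
  qed
  also have "integral {a..b} (\<lambda>s. G (w + s)) = integral {a + w..b + w} G"
    using integral_shift_Icc_real[of a b G w] by (simp add: o_def)
  also have "\<dots> = integral {a..b} G + integral {b..b + w} G - integral {a..a + w} G"
    using Henstock_Kurzweil_Integration.integral_combine[of a b "b + w" G]
      Henstock_Kurzweil_Integration.integral_combine[of a "a + w" "b + w" G] G_int ab w
    by (simp add: algebra_simps)
  finally have "2 * integral {a..b} G = integral {a..b} G - integral {a..b} (\<lambda>s. r (s + w) * of_real (sin (M * s)))
      + integral {a..a + w} G - integral {b..b + w} G"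
    by (simp add: algebra_simps)
  also have "integral {a..b} G - integral {a..b} (\<lambda>s. r (s + w) * of_real (sin (M * s)))
     = integral {a..b} (\<lambda>s. (r s - r (s + w)) * of_real (sin (M * s)))"
    unfolding G_def left_diff_distrib
    by (intro Henstock_Kurzweil_Integration.integral_diff[symmetric] integrable_continuous_real continuous_intros)
  finally have *: "2 * integral {a..b} G = integral {a..b} (\<lambda>s. (r s - r (s + w)) * of_real (sin (M * s)))
      + integral {a..a + w} G - integral {b..b + w} G" .
  have "norm (integral {a..b} (\<lambda>s. (r s - r (s + w)) * of_real (sin (M * s)))) \<le> Q * w * (b - a)"
  proof (intro integral_bound continuous_intros ab)
    fix s
    show "norm ((r s - r (s + w)) * of_real (sin (M * s))) \<le> Q * w"
      using mult_mono[of "norm (r s - r (s + w))" "Q * w" "\<bar>sin (M * s)\<bar>" 1] r_lip[of s "s + w"] w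
        lipschitz_on_nonneg[OF q] by (simp add: norm_mult)
  qed
  then have "norm (2 * integral {a..b} G) \<le> Q * w * (b - a) + B * w + B * w"
    unfolding * using short by (intro norm_triangle_le norm_triangle_le_diff add_mono)
  then have "norm (integral {a..b} G) \<le> (Q * (b - a) + 2 * B) * pi / (2 * M)"
    using M by (simp add: norm_mult w_def field_simps)
  also have "integral {a..b} G = integral {a..b} (\<lambda>s. q s * of_real (sin (M * s)))"
    by (intro integral_cong) (auto simp: G_def r_def)
  finally show ?thesis .
qed

text \<open>
  The constant depends on \<open>L\<close> and \<open>\<eta>\<close> only; its independence of \<open>t\<close> is what makes the
  convergence of the Fourier series uniform.
\<close>

lemma second_difference_quotient_lipschitz:
  fixes f :: "real \<Rightarrow> complex"
  assumes L: "L-lipschitz_on UNIV f" and bd: "\<And>t. norm (f t) \<le> 1"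
    and \<eta>: "0 < \<eta>" "\<eta> \<le> pi"
  shows "(2 * L * (pi / \<eta>) + 2 * (pi / \<eta>)^2)-lipschitz_on {\<eta>..pi}
    (\<lambda>s. (f (t + s) + f (t - s) - 2 * f t) / of_real (sin (s / 2)))"
proof (rule lipschitz_onI)
  define h where "h s = f (t + s) + f (t - s) - 2 * f t" for s
  define v where "v s = 1 / sin (s / 2)" for s :: real
  have L0: "L \<ge> 0" by (rule lipschitz_on_nonneg[OF L])
  fix x y assume xy: "x \<in> {\<eta>..pi}" "y \<in> {\<eta>..pi}"
  have v_bd: "0 \<le> v s \<and> v s \<le> pi / \<eta>" if "s \<in> {\<eta>..pi}" for s
  proof -
    have "pi / s \<le> pi / \<eta>" using that \<eta> by (intro divide_left_mono) auto
    then show ?thesis using inverse_sin_half_le[of s] sin_half_pos[of s] that \<eta> by (auto simp: v_def)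
  qed
  have h_lip: "norm (h x - h y) \<le> 2 * L * \<bar>x - y\<bar>"
  proof -
    have "norm (f (t + x) - f (t + y)) \<le> L * \<bar>x - y\<bar>" "norm (f (t - x) - f (t - y)) \<le> L * \<bar>x - y\<bar>"
      using lipschitz_onD[OF L, of "t + x" "t + y"] lipschitz_onD[OF L, of "t - x" "t - y"]
      by (auto simp: dist_norm abs_minus_commute)
    then show ?thesis
      using norm_triangle_ineq[of "f (t + x) - f (t + y)" "f (t - x) - f (t - y)"]
      by (simp add: h_def algebra_simps)
  qed
  have v_lip: "\<bar>v x - v y\<bar> \<le> (pi / \<eta>)^2 / 2 * \<bar>x - y\<bar>"
  proof -
    have "\<bar>sin (y / 2) - sin (x / 2)\<bar> \<le> \<bar>y / 2 - x / 2\<bar>"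
    proof -
      have "1-lipschitz_on UNIV (sin :: real \<Rightarrow> real)"
      proof (rule bounded_derivative_imp_lipschitz)
        show "(sin has_derivative (\<lambda>h. h * cos x)) (at x within UNIV)" for x :: real
          by (auto intro!: derivative_eq_intros simp: has_derivative_sin)
        show "onorm (\<lambda>h. h * cos x) \<le> 1" for x :: real
          by (rule onorm_le) (simp add: abs_mult mult_left_le)
      qed auto
      from lipschitz_onD[OF this, of "y/2" "x/2"] show ?thesis by (simp add: dist_real_def)
    qed
    then have s: "\<bar>sin (y / 2) - sin (x / 2)\<bar> \<le> \<bar>x - y\<bar> / 2" by (simp add: field_simps)
    have pos: "sin (x / 2) > 0" "sin (y / 2) > 0" using sin_half_pos xy \<eta> by auto
    have "\<bar>v x - v y\<bar> = \<bar>sin (y / 2) - sin (x / 2)\<bar> * (v x * v y)"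
    proof -
      have "v x - v y = (sin (y / 2) - sin (x / 2)) * (v x * v y)"
        using pos by (simp add: v_def field_simps)
      then show ?thesis using v_bd xy by (simp add: abs_mult)
    qed
    also have "\<dots> \<le> \<bar>x - y\<bar> / 2 * (pi / \<eta> * (pi / \<eta>))"
      using s v_bd xy \<eta> by (intro mult_mono) auto
    finally show ?thesis by (simp add: power2_eq_square algebra_simps)
  qed
  have "h x * of_real (v x) - h y * of_real (v y) = (h x - h y) * of_real (v x) + h y * of_real (v x - v y)"
    by (simp add: algebra_simps)
  also have "norm \<dots> \<le> 2 * L * \<bar>x - y\<bar> * (pi / \<eta>) + 4 * ((pi / \<eta>)^2 / 2 * \<bar>x - y\<bar>)"
  proof (intro norm_triangle_le add_mono)
    show "norm ((h x - h y) * of_real (v x)) \<le> 2 * L * \<bar>x - y\<bar> * (pi / \<eta>)"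
      unfolding norm_mult norm_of_real using v_bd[OF xy(1)] L0 by (intro mult_mono h_lip) simp_all
    show "norm (h y * of_real (v x - v y)) \<le> 4 * ((pi / \<eta>)^2 / 2 * \<bar>x - y\<bar>)"
      unfolding norm_mult norm_of_real h_def
      by (intro mult_mono v_lip norm_second_difference_le_4 bd) simp_all
  qed
  also have "\<dots> = (2 * L * (pi / \<eta>) + 2 * (pi / \<eta>)^2) * \<bar>x - y\<bar>"
    by (simp add: algebra_simps)
  finally show "dist ((f (t + x) + f (t - x) - 2 * f t) / of_real (sin (x / 2)))
     ((f (t + y) + f (t - y) - 2 * f t) / of_real (sin (y / 2))) \<le> (2 * L * (pi / \<eta>) + 2 * (pi / \<eta>)^2) * dist x y"
    by (simp add: dist_norm h_def v_def del: of_real_diff)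
qed (use lipschitz_on_nonneg[OF L] \<eta> in auto)

text \<open>
  Unlike in \<open>norm_fourier_sum_minus_le\<close>, the oscillation of the kernel is exploited away from
  \<open>0\<close>: for fixed \<open>\<eta>\<close> that part of the integral tends to \<open>0\<close> as \<open>N\<close> grows.
\<close>

lemma norm_fourier_sum_minus_le_decay:
  fixes f :: "real \<Rightarrow> complex"
  assumes f: "f \<in> circle_C" and L: "L-lipschitz_on UNIV f" and bd: "\<And>t. norm (f t) \<le> 1"
    and \<eta>: "0 < \<eta>" "\<eta> \<le> pi"
  shows "\<exists>C. \<forall>N t. norm (fourier_sum N f t - f t) \<le> L * \<eta> + C / (real N + 1/2)"
proof -
  define Q where "Q = 2 * L * (pi / \<eta>) + 2 * (pi / \<eta>)^2"
  define C where "C = (Q * (pi - \<eta>) + 2 * (4 * (pi / \<eta>))) * pi / 2"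
  have "norm (fourier_sum N f t - f t) \<le> L * \<eta> + (C / (2 * pi)) / (real N + 1/2)" for N t
  proof -
  define h where "h s = f (t + s) + f (t - s) - 2 * f t" for s
  define M where "M = real N + 1/2"
  have M: "M > 0" by (simp add: M_def)
  have "integral {\<eta>..pi} (\<lambda>s. h s * of_real (dirichlet_kernel N s))
     = integral {\<eta>..pi} (\<lambda>s. h s / of_real (sin (s / 2)) * of_real (sin (M * s)))"
    using \<eta> by (intro integral_cong) (simp add: dirichlet_kernel_eq M_def)
  also have "norm \<dots> \<le> (Q * (pi - \<eta>) + 2 * (4 * (pi / \<eta>))) * pi / (2 * M)"
  proof (rule norm_integral_mult_sin_le[OF \<eta>(2) _ _ M])
    show "Q-lipschitz_on {\<eta>..pi} (\<lambda>s. h s / of_real (sin (s / 2)))"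
      unfolding Q_def h_def by (intro second_difference_quotient_lipschitz L bd \<eta>)
    fix s assume s: "s \<in> {\<eta>..pi}"
    have "norm (h s / of_real (sin (s / 2))) = norm (h s) * (1 / sin (s / 2))"
      using sin_half_pos[of s] s \<eta> by (simp add: norm_divide)
    also have "\<dots> \<le> 4 * (pi / s)"
      using inverse_sin_half_le[of s] sin_half_pos[of s] s \<eta> norm_second_difference_le_4[of f t s, OF bd]
      by (intro mult_mono) (auto simp: h_def)
    also have "pi / s \<le> pi / \<eta>" using s \<eta> by (intro divide_left_mono) auto
    finally show "norm (h s / of_real (sin (s / 2))) \<le> 4 * (pi / \<eta>)" by simp
  qed
  finally have far: "norm (integral {\<eta>..pi} (\<lambda>s. h s * of_real (dirichlet_kernel N s))) \<le> C / M"
    by (simp add: C_def)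
  have near: "norm (integral {0..\<eta>} (\<lambda>s. h s * of_real (dirichlet_kernel N s))) \<le> 2 * pi * L * \<eta>"
    unfolding h_def using norm_integral_near_zero_le[OF f L] \<eta> by auto
  have "norm (fourier_sum N f t - f t) = 1 / (2 * pi) * 
     norm (integral {0..\<eta>} (\<lambda>s. h s * of_real (dirichlet_kernel N s)) + integral {\<eta>..pi} (\<lambda>s. h s * of_real (dirichlet_kernel N s)))"
    using fourier_sum_minus_split[OF f, of \<eta> N t] \<eta> by (simp add: norm_mult norm_divide h_def)
  also have "\<dots> \<le> 1 / (2 * pi) * (2 * pi * L * \<eta> + C / M)"
    using near far by (intro mult_left_mono norm_triangle_le) auto
  also have "\<dots> = L * \<eta> + (C / (2 * pi)) / M"
    by (simp add: field_simps)
  finally show ?thesis by (simp only: M_def)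
  qed
  then show ?thesis by blast
qed

lemma lipschitz_in_circle_U:
  fixes f :: "real \<Rightarrow> complex"
  assumes f: "f \<in> circle_C" and L: "L-lipschitz_on UNIV f" and bd: "\<And>t. norm (f t) \<le> 1"
  shows "f \<in> circle_U"
proof -
  have "(\<lambda>N. C_norm (\<lambda>t. fourier_sum N f t - f t)) \<longlonglongrightarrow> 0"
  proof (rule LIMSEQ_I)
    fix e :: real assume e: "e > 0"
    have L0: "L \<ge> 0" by (rule lipschitz_on_nonneg[OF L])
    define \<eta> where "\<eta> = min pi (e / (4 * (L + 1)))"
    have \<eta>: "0 < \<eta>" "\<eta> \<le> pi" using e L0 by (auto simp: \<eta>_def)
    have "L * \<eta> \<le> L * (e / (4 * (L + 1)))" using L0 by (intro mult_left_mono) (auto simp: \<eta>_def)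
    also have "\<dots> \<le> e / 4" using L0 e by (simp add: field_simps)
    finally have L\<eta>: "L * \<eta> \<le> e / 4" .
    obtain C where C: "norm (fourier_sum N f t - f t) \<le> L * \<eta> + C / (real N + 1/2)" for N t
      using norm_fourier_sum_minus_le_decay[OF f L bd \<eta>] by blast
    have "(\<lambda>N. C / (real N + 1/2)) \<longlonglongrightarrow> 0" 
      by (subst add.commute, intro tendsto_divide_0[OF tendsto_const] filterlim_at_top_imp_at_infinity
          filterlim_tendsto_add_at_top[OF tendsto_const] filterlim_real_sequentially)
    then have "eventually (\<lambda>N. C / (real N + 1/2) < e / 4) sequentially"
      using e by (intro order_tendstoD) auto
    then obtain N0 where N0: "\<And>N. N \<ge> N0 \<Longrightarrow> C / (real N + 1/2) < e / 4"
      by (auto simp: eventually_sequentially)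
    show "\<exists>N0. \<forall>N\<ge>N0. norm (C_norm (\<lambda>t. fourier_sum N f t - f t) - 0) < e"
    proof (intro exI allI impI)
      fix N assume "N \<ge> N0"
      then have *: "norm (fourier_sum N f t - f t) \<le> e / 2" for t
        using C[of N t] N0[OF \<open>N \<ge> N0\<close>] L\<eta> by linarith
      have "C_norm (\<lambda>t. fourier_sum N f t - f t) \<le> e / 2"
        unfolding C_norm_def using * by (intro cSUP_least) auto
      moreover have "0 \<le> C_norm (\<lambda>t. fourier_sum N f t - f t)"
      proof -
        have "norm (fourier_sum N f 0 - f 0) \<le> C_norm (\<lambda>t. fourier_sum N f t - f t)"
          unfolding C_norm_def using * by (intro cSUP_upper bdd_aboveI2[where M = "e/2"]) auto
        then show ?thesis using norm_ge_zero order_trans by blast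
      qed
      ultimately show "norm (C_norm (\<lambda>t. fourier_sum N f t - f t) - 0) < e" using e by simp
    qed
  qed
  then show ?thesis using f by (simp add: circle_U_def)
qed

text \<open>
  Both suprema in the norm are real-valued, so a uniform bound on the partial sums is what
  makes them behave as suprema.
\<close>

lemma U_norm_bounds:
  assumes "\<And>N t. norm (fourier_sum N f t) \<le> B"
  shows "U_norm f \<le> B" "norm (fourier_sum N f t) \<le> U_norm f"
proof -
  have C: "C_norm (fourier_sum N f) \<le> B" for N
    unfolding C_norm_def using assms by (intro cSUP_least) auto
  then show "U_norm f \<le> B"
    unfolding U_norm_def by (intro cSUP_least) auto
  have "norm (fourier_sum N f t) \<le> C_norm (fourier_sum N f)"
    unfolding C_norm_def using assms by (intro cSUP_upper bdd_aboveI2[where M = B]) auto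
  also have "\<dots> \<le> U_norm f"
    unfolding U_norm_def using C by (intro cSUP_upper bdd_aboveI2[where M = B]) auto
  finally show "norm (fourier_sum N f t) \<le> U_norm f" .
qed

section \<open>Piecewise linear circle maps\<close>

text \<open>
  The quotient \<open>(\<phi>(t + 2\<pi>) - \<phi>(t)) / 2\<pi>\<close> is continuous and integer-valued, hence constant: it is
  the degree of the map.
\<close>

lemma circle_map_degree:
  assumes "circle_map \<phi>"
  shows "\<exists>m::int. \<forall>t. \<phi> (t + 2 * pi) = \<phi> t + 2 * pi * m"
proof -
  define g where "g t = (\<phi> (t + 2 * pi) - \<phi> t) / (2 * pi)" for t
  have cont: "continuous_on UNIV \<phi>" and per: "[\<phi> (t + 2 * pi) = \<phi> t] (rmod (2 * pi))" for t
    using assms by (auto simp: circle_map_def)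
  have "continuous_on UNIV (\<lambda>t. \<phi> (t + 2 * pi))"
    by (rule continuous_on_compose2[OF cont]) (auto intro!: continuous_intros)
  then have g_cont: "continuous_on UNIV g"
    unfolding g_def using cont by (intro continuous_intros) auto
  have g_int: "g t \<in> \<int>" for t
  proof -
    have "\<phi> (t + 2 * pi) - \<phi> t = 2 * pi * of_int (\<lfloor>\<phi> (t + 2 * pi) / (2 * pi)\<rfloor> - \<lfloor>\<phi> t / (2 * pi)\<rfloor>)"
      using per[of t] by (simp add: rcong_def rmod_def algebra_simps)
    then have "g t = of_int (\<lfloor>\<phi> (t + 2 * pi) / (2 * pi)\<rfloor> - \<lfloor>\<phi> t / (2 * pi)\<rfloor>)"
      by (simp add: g_def)
    then show ?thesis by (metis Ints_of_int)
  qed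
  have "g constant_on UNIV"
  proof (rule continuous_discrete_range_constant[OF connected_UNIV g_cont])
    fix x :: real
    have "1 \<le> norm (g y - g x)" if "g y \<noteq> g x" for y
      using Ints_nonzero_abs_ge1[of "g y - g x"] g_int that by auto
    then show "\<exists>e>0. \<forall>y. y \<in> UNIV \<and> g y \<noteq> g x \<longrightarrow> e \<le> norm (g y - g x)"
      by (intro exI[of _ 1]) auto
  qed
  then obtain c where c: "\<And>t. g t = c" by (auto simp: constant_on_def)
  then obtain m :: int where "c = m" using g_int[of 0] by (auto elim: Ints_cases)
  then show ?thesis using c by (intro exI[of _ m]) (auto simp: g_def field_simps)
qed

lemma circle_map_shift_int:
  fixes m :: int
  assumes "\<And>t. \<phi> (t + 2 * pi) = \<phi> t + 2 * pi * m"
  shows "\<phi> (t + 2 * pi * of_int k) = \<phi> t + 2 * pi * m * of_int k"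
proof (induction k rule: int_induct[where k = 0])
  case (step1 i)
  then show ?case using assms[of "t + 2 * pi * of_int i"] by (simp add: algebra_simps)
next
  case (step2 i)
  then show ?case using assms[of "t + 2 * pi * of_int (i - 1)"] by (simp add: algebra_simps)
qed simp

text \<open>
  By continuity \<open>\<phi>\<close> is affine on the closure of each piece, and a function that is Lipschitz on
  finitely many closed sets is Lipschitz on any interval they cover. Translates by
  multiples of \<open>2\<pi>\<close> extend this to the whole line.
\<close>

lemma piecewise_linear_lipschitz:
  assumes "circle_map \<phi>" and "piecewise_linear \<phi>"
  shows "\<exists>A. A-lipschitz_on UNIV \<phi>"
proof -
  have cont: "continuous_on S \<phi>" for S
    using assms(1) continuous_on_subset[of UNIV \<phi> S] by (auto simp: circle_map_def)
  obtain m :: int where m: "\<And>t. \<phi> (t + 2 * pi) = \<phi> t + 2 * pi * m"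
    using circle_map_degree[OF assms(1)] by blast
  obtain \<I> where \<I>: "finite \<I>" "\<Union>\<I> = {0..2*pi}" "\<forall>I\<in>\<I>. is_interval I \<and> affine_linear_on I \<phi>"
    using assms(2) by (auto simp: piecewise_linear_def)
  then obtain a b where ab: "\<And>I t. I \<in> \<I> \<Longrightarrow> t \<in> I \<Longrightarrow> \<phi> t = a I * t + b I"
    unfolding affine_linear_on_def by metis
  define A where "A = (\<Sum>I\<in>\<I>. \<bar>a I\<bar>)"
  have A0: "A \<ge> 0" by (simp add: A_def sum_nonneg)
  have aA: "\<bar>a I\<bar> \<le> A" if "I \<in> \<I>" for I
    unfolding A_def using \<I>(1) that by (intro member_le_sum) auto
  have base: "A-lipschitz_on {0..2*pi} \<phi>"
  proof (rule lipschitz_on_closed_Union[OF _ _ \<I>(1) A0])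
    fix I assume I: "I \<in> \<I>"
    have "A-lipschitz_on I \<phi>"
    proof (rule lipschitz_onI)
      fix x y assume "x \<in> I" "y \<in> I"
      then have "dist (\<phi> x) (\<phi> y) = \<bar>a I\<bar> * dist x y"
        using ab[OF I] by (simp add: dist_real_def abs_mult[symmetric] algebra_simps)
      then show "dist (\<phi> x) (\<phi> y) \<le> A * dist x y"
        using aA[OF I] by (simp add: mult_right_mono)
    qed (rule A0)
    then show "A-lipschitz_on (closure I) \<phi>" by (rule lipschitz_on_closure) (rule cont)
  next
    show "{0..2*pi} \<subseteq> (\<Union>I\<in>\<I>. closure I)"
    proof
      fix t assume "t \<in> {0..2*pi}"
      then obtain I where "I \<in> \<I>" "t \<in> I" using \<I>(2) by blast
      then show "t \<in> (\<Union>I\<in>\<I>. closure I)" using closure_subset[of I] by blast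
    qed
  qed auto
  have shifted: "A-lipschitz_on {2 * pi * of_int k..2 * pi * of_int k + 2 * pi} \<phi>" for k
  proof (rule lipschitz_onI)
    fix x y assume xy: "x \<in> {2 * pi * of_int k..2 * pi * of_int k + 2 * pi}" "y \<in> {2 * pi * of_int k..2 * pi * of_int k + 2 * pi}"
    then have "dist (\<phi> (x - 2 * pi * of_int k)) (\<phi> (y - 2 * pi * of_int k)) \<le> A * dist x y"
      using lipschitz_onD[OF base, of "x - 2 * pi * of_int k" "y - 2 * pi * of_int k"] by (auto simp: dist_real_def)
    then show "dist (\<phi> x) (\<phi> y) \<le> A * dist x y"
      using circle_map_shift_int[of \<phi> m "x - 2 * pi * of_int k" k, OF m]
        circle_map_shift_int[of \<phi> m "y - 2 * pi * of_int k" k, OF m] by (simp add: dist_real_def)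
  qed (rule A0)
  have "A-lipschitz_on UNIV \<phi>"
  proof (rule lipschitz_on_leI)
    fix x y :: real assume "x \<le> y"
    have "A-lipschitz_on {x..y} \<phi>"
    proof (rule lipschitz_on_closed_Union[OF shifted _ _ A0])
      show "{x..y} \<subseteq> (\<Union>k\<in>{\<lfloor>x / (2 * pi)\<rfloor>..\<lfloor>y / (2 * pi)\<rfloor>}. {2 * pi * of_int k..2 * pi * of_int k + 2 * pi})"
      proof
        fix t assume t: "t \<in> {x..y}"
        have "\<lfloor>t / (2 * pi)\<rfloor> \<in> {\<lfloor>x / (2 * pi)\<rfloor>..\<lfloor>y / (2 * pi)\<rfloor>}"
          using t by (auto intro!: floor_mono divide_right_mono)
        moreover have "t \<in> {2 * pi * of_int \<lfloor>t / (2 * pi)\<rfloor>..2 * pi * of_int \<lfloor>t / (2 * pi)\<rfloor> + 2 * pi}"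
          using floor_divide_lower[of "2 * pi" t] floor_divide_upper[of "2 * pi" t] by (auto simp: algebra_simps)
        ultimately show "t \<in> (\<Union>k\<in>{\<lfloor>x / (2 * pi)\<rfloor>..\<lfloor>y / (2 * pi)\<rfloor>}. {2 * pi * of_int k..2 * pi * of_int k + 2 * pi})"
          by blast
      qed
    qed auto
    then show "dist (\<phi> x) (\<phi> y) \<le> A * dist x y"
      using \<open>x \<le> y\<close> by (auto dest: lipschitz_onD)
  qed (rule A0)
  then show ?thesis by blast
qed

text \<open>
  Finitely many pieces cover a one-sided neighbourhood of \<open>t0\<close>, so one of them contains points
  arbitrarily close to \<open>t0\<close>; being an interval, it contains a one-sided punctured neighbourhood. The sign
  \<open>\<sigma>\<close> treats both sides at once.
\<close>

lemma one_sided_affine_fundamental_interval: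
  fixes \<sigma> t0 :: real
  assumes cont: "continuous_on UNIV \<phi>" and pl: "piecewise_linear \<phi>" and \<sigma>: "\<sigma> = 1 \<or> \<sigma> = -1"
    and ev: "eventually (\<lambda>s. t0 + \<sigma> * s \<in> {0..2*pi}) (at_right 0)"
  shows "\<exists>a \<delta>. \<delta> > 0 \<and> (\<forall>s\<in>{0..\<delta>}. \<phi> (t0 + \<sigma> * s) = \<phi> t0 + a * s)"
proof -
  obtain \<I> where \<I>: "finite \<I>" "\<Union>\<I> = {0..2*pi}" "\<forall>I\<in>\<I>. is_interval I \<and> affine_linear_on I \<phi>"
    using pl by (auto simp: piecewise_linear_def)
  have "\<exists>I\<in>\<I>. frequently (\<lambda>s. t0 + \<sigma> * s \<in> I) (at_right 0)"
  proof (rule ccontr)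
    assume "\<not> ?thesis"
    then have "\<forall>I\<in>\<I>. eventually (\<lambda>s. t0 + \<sigma> * s \<notin> I) (at_right 0)"
      by (simp add: not_frequently)
    then have "eventually (\<lambda>s. \<forall>I\<in>\<I>. t0 + \<sigma> * s \<notin> I) (at_right 0)"
      using \<I>(1) by (simp add: eventually_ball_finite)
    then have "eventually (\<lambda>s::real. False) (at_right 0)"
      using ev by eventually_elim (use \<I>(2) in blast)
    then show False by simp
  qed
  then obtain I where I: "I \<in> \<I>" and fr: "frequently (\<lambda>s. t0 + \<sigma> * s \<in> I) (at_right 0)" by blast
  have arb: "\<exists>s. 0 < s \<and> s < e \<and> t0 + \<sigma> * s \<in> I" if "e > 0" for e
  proof -
    have "eventually (\<lambda>s. s \<in> {0<..<e}) (at_right 0)"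
      using that by (rule eventually_at_right_real)
    from frequently_eventually_frequently[OF fr this] show ?thesis
      by (auto dest!: frequently_ex)
  qed
  obtain \<delta> where \<delta>: "\<delta> > 0" "t0 + \<sigma> * \<delta> \<in> I" using arb[of 1] by auto
  obtain a b where ab: "\<And>t. t \<in> I \<Longrightarrow> \<phi> t = a * t + b"
    using I \<I>(3) by (auto simp: affine_linear_on_def)
  have aff: "\<phi> (t0 + \<sigma> * s) = a * (t0 + \<sigma> * s) + b" if s: "s \<in> {0<..\<delta>}" for s
  proof -
    obtain s' where s': "0 < s'" "s' < s" "t0 + \<sigma> * s' \<in> I" using arb[of s] s by auto
    have "t0 + \<sigma> * s \<in> I"
      using \<sigma> s s' \<delta> I \<I>(3) mem_is_interval_1_I[of I "t0 + \<sigma> * s'" "t0 + \<sigma> * \<delta>" "t0 + \<sigma> * s"]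
        mem_is_interval_1_I[of I "t0 + \<sigma> * \<delta>" "t0 + \<sigma> * s'" "t0 + \<sigma> * s"] by auto
    then show ?thesis by (rule ab)
  qed
  \<comment> \<open>The piece need not contain \<open>t0\<close> itself; continuity transfers its affine formula to that point.\<close>
  define F where "F s = \<phi> (t0 + \<sigma> * s) - (a * (t0 + \<sigma> * s) + b)" for s
  have "continuous_on UNIV (\<lambda>s. \<phi> (t0 + \<sigma> * s))"
    by (rule continuous_on_compose2[OF cont]) (auto intro!: continuous_intros)
  then have F_cont: "continuous_on UNIV F"
    unfolding F_def by (intro continuous_intros)
  have "F 0 = 0"
  proof (rule tendsto_unique)
    show "(F \<longlongrightarrow> F 0) (at_right 0)"
      using F_cont by (simp add: continuous_on_eq_continuous_at isCont_def filterlim_at_split)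
    have "eventually (\<lambda>s. s \<in> {0<..<\<delta>}) (at_right 0)"
      using \<delta>(1) by (rule eventually_at_right_real)
    then have "eventually (\<lambda>s. F s = 0) (at_right 0)"
      by eventually_elim (use aff in \<open>auto simp: F_def\<close>)
    then show "(F \<longlongrightarrow> 0) (at_right 0)" by (rule tendsto_eventually)
  qed simp
  then have "\<phi> (t0 + \<sigma> * s) = \<phi> t0 + (\<sigma> * a) * s" if "s \<in> {0..\<delta>}" for s
    using aff[of s] that by (cases "s = 0") (auto simp: F_def algebra_simps)
  then show ?thesis using \<delta>(1) by blast
qed

lemma one_sided_affine:
  fixes \<sigma> t0 :: real
  assumes cm: "circle_map \<phi>" and pl: "piecewise_linear \<phi>" and \<sigma>: "\<sigma> = 1 \<or> \<sigma> = -1"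
  shows "\<exists>a \<delta>. \<delta> > 0 \<and> (\<forall>s\<in>{0..\<delta>}. \<phi> (t0 + \<sigma> * s) = \<phi> t0 + a * s)"
proof -
  obtain m :: int where m: "\<And>t. \<phi> (t + 2 * pi) = \<phi> t + 2 * pi * m"
    using circle_map_degree[OF cm] by blast
  have cont: "continuous_on UNIV \<phi>" using cm by (simp add: circle_map_def)
  \<comment> \<open>Translates \<open>t0\<close> into \<open>[0, 2\<pi>)\<close> for the right side and into \<open>(0, 2\<pi>]\<close> for the left side.\<close>
  define k where "k = (if \<sigma> = 1 then \<lfloor>t0 / (2 * pi)\<rfloor> else \<lceil>t0 / (2 * pi)\<rceil> - 1)"
  define t1 where "t1 = t0 - 2 * pi * of_int k"
  have "eventually (\<lambda>s. t1 + \<sigma> * s \<in> {0..2*pi}) (at_right 0)"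
  proof (cases "\<sigma> = 1")
    case True
    then have "0 \<le> t1" "t1 < 2 * pi"
      using floor_divide_lower[of "2 * pi" t0] floor_divide_upper[of "2 * pi" t0]
      by (auto simp: t1_def k_def algebra_simps)
    then have "0 < 2 * pi - t1" by simp
    then have "eventually (\<lambda>s. s \<in> {0<..<2 * pi - t1}) (at_right 0)"
      by (rule eventually_at_right_real)
    then show ?thesis by eventually_elim (use True \<open>0 \<le> t1\<close> in auto)
  next
    case False
    then have "0 < t1" "t1 \<le> 2 * pi"
      using ceiling_divide_lower[of "2 * pi" t0] ceiling_divide_upper[of "2 * pi" t0]
      by (auto simp: t1_def k_def algebra_simps)
    then have "eventually (\<lambda>s. s \<in> {0<..<t1}) (at_right 0)"
      by (intro eventually_at_right_real)
    then show ?thesis by eventually_elim (use False \<sigma> \<open>t1 \<le> 2 * pi\<close> in auto)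
  qed
  from one_sided_affine_fundamental_interval[OF cont pl \<sigma> this] obtain a \<delta> where
    \<delta>: "\<delta> > 0" and a: "\<And>s. s \<in> {0..\<delta>} \<Longrightarrow> \<phi> (t1 + \<sigma> * s) = \<phi> t1 + a * s" by blast
  have "\<phi> (t0 + \<sigma> * s) = \<phi> t0 + a * s" if "s \<in> {0..\<delta>}" for s
    using a[OF that] circle_map_shift_int[of \<phi> m "t1 + \<sigma> * s" k, OF m] circle_map_shift_int[of \<phi> m t1 k, OF m]
    by (simp add: t1_def algebra_simps)
  then show ?thesis using \<delta> by blast
qed

text \<open>
  Without corners \<open>\<phi>\<close> would be affine near every point, hence differentiable with a locally constant, thus
  constant, derivative, and so affine on the line. Arguing on the line instead of \<open>[0, 2\<pi>]\<close>
  also covers the case where the only corner is at \<open>0\<close> modulo \<open>2\<pi>\<close>.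
  With \<open>\<gamma>\<close> the slope in the direction away from \<open>t0\<close>, the left derivative is \<open>- \<gamma>\<close>, so
  \<open>\<beta> + \<gamma> \<noteq> 0\<close> says that the one-sided derivatives differ.
\<close>

lemma exists_corner:
  assumes cm: "circle_map \<phi>" and pl: "piecewise_linear \<phi>" and na: "\<not> affine_linear_on UNIV \<phi>"
  obtains t0 \<beta> \<gamma> \<delta> where "\<delta> > 0" "\<beta> + \<gamma> \<noteq> 0"
    "\<And>s. s \<in> {0..\<delta>} \<Longrightarrow> \<phi> (t0 + s) = \<phi> t0 + \<beta> * s"
    "\<And>s. s \<in> {0..\<delta>} \<Longrightarrow> \<phi> (t0 - s) = \<phi> t0 + \<gamma> * s"
proof (rule ccontr)
  note corner = that
  assume "\<not> thesis"
  then have nocorner: "\<beta> + \<gamma> = 0" if "\<delta> > 0" "\<And>s. s \<in> {0..\<delta>} \<Longrightarrow> \<phi> (t0 + s) = \<phi> t0 + \<beta> * s"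
    "\<And>s. s \<in> {0..\<delta>} \<Longrightarrow> \<phi> (t0 - s) = \<phi> t0 + \<gamma> * s" for t0 \<beta> \<gamma> \<delta>
    using corner[of \<delta> \<beta> \<gamma> t0] that by blast
  have "\<exists>d \<delta>. \<delta> > 0 \<and> (\<forall>x. \<bar>x - t\<bar> < \<delta> \<longrightarrow> \<phi> x = \<phi> t + d * (x - t))" for t
  proof -
    obtain \<beta> \<delta>1 where 1: "\<delta>1 > 0" "\<And>s. s \<in> {0..\<delta>1} \<Longrightarrow> \<phi> (t + s) = \<phi> t + \<beta> * s"
      using one_sided_affine[OF cm pl disjI1[OF refl], of t] unfolding mult_1 by blast
    obtain \<gamma> \<delta>2 where 2: "\<delta>2 > 0" "\<And>s. s \<in> {0..\<delta>2} \<Longrightarrow> \<phi> (t - s) = \<phi> t + \<gamma> * s"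
      using one_sided_affine[OF cm pl disjI2[OF refl], of t] unfolding mult_minus1 add_uminus_conv_diff by blast
    have "\<gamma> = - \<beta>"
      using nocorner[of "min \<delta>1 \<delta>2" t \<beta> \<gamma>] 1 2 by auto
    have "\<phi> x = \<phi> t + \<beta> * (x - t)" if "\<bar>x - t\<bar> < min \<delta>1 \<delta>2" for x
    proof (cases "x \<ge> t")
      case True
      then have "\<phi> (t + (x - t)) = \<phi> t + \<beta> * (x - t)" using that by (intro 1(2)) auto
      then show ?thesis by simp
    next
      case False
      then have "\<phi> (t - (t - x)) = \<phi> t + \<gamma> * (t - x)" using that by (intro 2(2)) auto
      then show ?thesis using \<open>\<gamma> = - \<beta>\<close> by (simp add: algebra_simps)
    qed
    moreover have "min \<delta>1 \<delta>2 > 0" using 1(1) 2(1) by simp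
    ultimately show ?thesis by blast
  qed
  then obtain d \<delta> where \<delta>: "\<And>t. \<delta> t > 0" and d: "\<And>t x. \<bar>x - t\<bar> < \<delta> t \<Longrightarrow> \<phi> x = \<phi> t + d t * (x - t)"
    by metis
  have deriv: "DERIV \<phi> u :> d t" if "\<bar>u - t\<bar> < \<delta> t" for t u
  proof (rule has_field_derivative_transform_within_open)
    show "((\<lambda>x. \<phi> t + d t * (x - t)) has_real_derivative d t) (at u)"
      by (auto intro!: derivative_eq_intros)
    show "\<phi> t + d t * (x - t) = \<phi> x" if "x \<in> ball t (\<delta> t)" for x
      using d[of x t] that by (auto simp: dist_real_def)
    show "u \<in> ball t (\<delta> t)" using that by (auto simp: dist_real_def)
  qed auto
  have d_const: "d t = d 0" for t
  proof (rule connected_local_const[of UNIV t 0 d])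
    show "\<forall>a\<in>UNIV. eventually (\<lambda>b. d a = d b) (at a within UNIV)"
    proof
      fix a
      have "d a = d b" if "dist b a < \<delta> a" for b
        using DERIV_unique[OF deriv[of b a] deriv[of b b]] that \<delta>[of b] by (auto simp: dist_real_def)
      then show "eventually (\<lambda>b. d a = d b) (at a within UNIV)"
        using \<delta>[of a] by (auto simp: eventually_at)
    qed
  qed auto
  have d0: "DERIV \<phi> u :> d 0" for u using deriv[of u u] \<delta>[of u] d_const[of u] by simp
  have "\<phi> t = d 0 * t + \<phi> 0" for t
  proof (cases "t = 0")
    case False
    then have "\<phi> t - \<phi> 0 = (t - 0) * d 0" by (intro DERIV_const_ratio_const d0) simp
    then show ?thesis by (simp add: algebra_simps)
  qed simp
  then have "affine_linear_on UNIV \<phi>" unfolding affine_linear_on_def by blast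
  then show False using na by blast
qed

section \<open>Resonance with the kernel\<close>

definition cos_kernel_integral :: "real \<Rightarrow> real \<Rightarrow> real \<Rightarrow> real" where
  "cos_kernel_integral \<omega> a b = integral {a..b} (\<lambda>s. cos (\<omega> * s) / sin (s / 2))"

lemma sin_half_nonzero:
  fixes s :: real
  assumes "0 < a" "b \<le> pi" "s \<in> {a..b}"
  shows "sin (s / 2) \<noteq> 0"
  using sin_half_pos[of s] assms by auto

text \<open>
  Integration by parts: \<open>1/sin(s/2)\<close> decreases on the interval, so its total variation together with the
  boundary terms is at most \<open>2/sin(a/2)\<close>. With \<open>a = 1/\<bar>n\<bar>\<close> and \<open>\<omega>\<close> of order
  \<open>\<bar>n\<bar>\<close> the bound is \<open>O(1)\<close>.
\<close>

lemma abs_cos_kernel_integral_le: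
  assumes ab: "0 < a" "a \<le> b" "b \<le> pi" and \<omega>: "\<omega> \<noteq> 0"
  shows "\<bar>cos_kernel_integral \<omega> a b\<bar> \<le> 2 * pi / (\<bar>\<omega>\<bar> * a)"
proof -
  have pos: "sin (s / 2) > 0" if "s \<in> {a..b}" for s
    using sin_half_pos[of s] that ab by auto
  \<comment> \<open>\<open>F\<close> is the boundary term and \<open>G\<close> the remaining integrand; \<open>H\<close> dominates \<open>G\<close> and is an exact derivative.\<close>
  define F where "F s = sin (\<omega> * s) / (\<omega> * sin (s / 2))" for s
  define G where "G s = sin (\<omega> * s) * cos (s / 2) / (2 * \<omega> * (sin (s / 2))^2)" for s
  define H where "H s = cos (s / 2) / (2 * (sin (s / 2))^2) / \<bar>\<omega>\<bar>" for s :: real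
  have F': "((\<lambda>s. cos (\<omega> * s) / sin (s / 2) - G s) has_integral (F b - F a)) {a..b}"
  proof (rule fundamental_theorem_of_calculus[OF ab(2)])
    fix s assume s: "s \<in> {a..b}"
    have "(F has_real_derivative cos (\<omega> * s) / sin (s / 2) - G s) (at s within {a..b})"
      unfolding F_def G_def using pos[OF s] \<omega>
      by (auto intro!: derivative_eq_intros simp: field_simps power2_eq_square)
    then show "(F has_vector_derivative cos (\<omega> * s) / sin (s / 2) - G s) (at s within {a..b})"
      by (simp add: has_real_derivative_iff_has_vector_derivative)
  qed
  have H': "(H has_integral (- (1 / (\<bar>\<omega>\<bar> * sin (b / 2))) - - (1 / (\<bar>\<omega>\<bar> * sin (a / 2))))) {a..b}"
  proof (rule fundamental_theorem_of_calculus[OF ab(2)])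
    fix s assume s: "s \<in> {a..b}"
    have "((\<lambda>s. - (1 / (\<bar>\<omega>\<bar> * sin (s / 2)))) has_real_derivative H s) (at s within {a..b})"
      unfolding H_def using pos[OF s] \<omega>
      by (auto intro!: derivative_eq_intros simp: field_simps power2_eq_square)
    then show "((\<lambda>s. - (1 / (\<bar>\<omega>\<bar> * sin (s / 2)))) has_vector_derivative H s) (at s within {a..b})"
      by (simp add: has_real_derivative_iff_has_vector_derivative)
  qed
  have nz: "\<forall>s\<in>{a..b}. sin (s / 2) \<noteq> 0" using pos by fastforce
  have G_int: "G integrable_on {a..b}"
    unfolding G_def using nz \<omega> by (intro integrable_continuous_real continuous_intros) auto
  have GH: "norm (integral {a..b} G) \<le> integral {a..b} H"
  proof (rule Henstock_Kurzweil_Integration.integral_norm_bound_integral[OF G_int])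
    show "H integrable_on {a..b}" using H' by blast
    fix s assume s: "s \<in> {a..b}"
    have "cos (s / 2) \<ge> 0" using s ab by (intro cos_ge_zero) auto
    then have "norm (G s) = \<bar>sin (\<omega> * s)\<bar> * H s"
      by (simp add: G_def H_def abs_mult)
    also have "\<dots> \<le> 1 * H s"
      using \<open>cos (s / 2) \<ge> 0\<close> by (intro mult_right_mono) (auto simp: H_def)
    finally show "norm (G s) \<le> H s" by simp
  qed
  have F_bd: "\<bar>F s\<bar> \<le> 1 / (\<bar>\<omega>\<bar> * sin (s / 2))" if "s \<in> {a..b}" for s
    using pos[OF that] \<omega> by (auto simp: F_def abs_mult intro!: divide_right_mono)
  have "((\<lambda>s. cos (\<omega> * s) / sin (s / 2) - G s + G s) has_integral (F b - F a + integral {a..b} G)) {a..b}"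
    using F' integrable_integral[OF G_int] by (rule has_integral_add)
  then have "cos_kernel_integral \<omega> a b = F b - F a + integral {a..b} G"
    unfolding cos_kernel_integral_def by (simp add: integral_unique)
  also have "\<bar>\<dots>\<bar> \<le> 1 / (\<bar>\<omega>\<bar> * sin (b / 2)) + 1 / (\<bar>\<omega>\<bar> * sin (a / 2)) + integral {a..b} H"
    using F_bd[of a] F_bd[of b] GH ab by auto
  also have "\<dots> = 2 / \<bar>\<omega>\<bar> * (1 / sin (a / 2))"
    using integral_unique[OF H'] by simp
  also have "\<dots> \<le> 2 / \<bar>\<omega>\<bar> * (pi / a)"
    using inverse_sin_half_le[of a] ab by (intro mult_left_mono) auto
  finally show ?thesis by simp
qed

text \<open>
  At resonance the cosine stays above \<open>1/2\<close> while \<open>1/sin(s/2) \<ge> 2/s\<close>.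
\<close>

lemma cos_kernel_integral_ge_ln:
  assumes ab: "0 < a" "a \<le> b" "b \<le> 1" and \<omega>: "\<bar>\<omega>\<bar> \<le> 1/2"
  shows "ln (b / a) \<le> cos_kernel_integral \<omega> a b"
proof -
  have pi3: "3 < pi" using pi_gt3 by simp
  have low: "((\<lambda>s. 1 / s) has_integral 1 * ln (b / a)) {a..b}"
    by (rule has_integral_const_div[OF ab(1,2)])
  have up: "((\<lambda>s. cos (\<omega> * s) / sin (s / 2)) has_integral cos_kernel_integral \<omega> a b) {a..b}"
    unfolding cos_kernel_integral_def using ab pi3 sin_half_nonzero[of a b]
    by (intro integrable_integral integrable_continuous_real continuous_intros) auto
  have "1 / s \<le> cos (\<omega> * s) / sin (s / 2)" if s: "s \<in> {a..b}" for s
  proof -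
    have pos: "0 < s" "0 < sin (s / 2)" using s ab pi3 sin_half_pos[of s] by auto
    have "\<bar>\<omega> * s\<bar> \<le> 1/2 * 1"
      unfolding abs_mult using s ab \<omega> by (intro mult_mono) auto
    then have "cos (pi / 3) \<le> cos \<bar>\<omega> * s\<bar>"
      using pi3 by (intro cos_monotone_0_pi_le) auto
    then have "1/2 \<le> cos (\<omega> * s)" by (simp add: cos_60)
    moreover have "sin (s / 2) \<le> s / 2" using pos by (intro sin_x_le_x) auto
    ultimately have "(1/2) / (s / 2) \<le> cos (\<omega> * s) / sin (s / 2)"
      using pos by (intro frac_le) auto
    then show ?thesis by simp
  qed
  from has_integral_le[OF low up this] show ?thesis by simp
qed

lemma integral_sin_sin_div:
  assumes ab: "0 < a" "b \<le> pi"
  shows "((\<lambda>s. sin (\<kappa> * s) * (sin (M * s) / sin (s / 2))) has_integral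
    (cos_kernel_integral (\<kappa> - M) a b - cos_kernel_integral (\<kappa> + M) a b) / 2) {a..b}"
proof -
  have *: "((\<lambda>s. cos (\<omega> * s) / sin (s / 2)) has_integral cos_kernel_integral \<omega> a b) {a..b}" for \<omega>
    unfolding cos_kernel_integral_def using ab sin_half_nonzero[of a b]
    by (intro integrable_integral integrable_continuous_real continuous_intros) auto
  have "((\<lambda>s. (cos ((\<kappa> - M) * s) / sin (s / 2) - cos ((\<kappa> + M) * s) / sin (s / 2)) / 2) has_integral
    (cos_kernel_integral (\<kappa> - M) a b - cos_kernel_integral (\<kappa> + M) a b) / 2) {a..b}"
    by (intro has_integral_divide has_integral_diff *)
  moreover have "(cos ((\<kappa> - M) * s) / sin (s / 2) - cos ((\<kappa> + M) * s) / sin (s / 2)) / 2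
     = sin (\<kappa> * s) * (sin (M * s) / sin (s / 2))" for s
    unfolding diff_divide_distrib[symmetric] by (simp add: left_diff_distrib distrib_right cos_diff cos_add)
  ultimately show ?thesis by simp
qed

text \<open>
  The product formula yields the frequencies \<open>K\<rho> \<plusminus> M\<close> and \<open>K\<gamma> \<plusminus> M\<close>. The first,
  \<open>K\<rho> - M\<close>, is resonant. If \<open>\<gamma> = \<rho>\<close> then so is \<open>K\<gamma> - M\<close>, with the same sign;
  otherwise the gap \<open>\<tau>\<close> keeps it, like the two sum frequencies, at distance at least \<open>K\<tau>/2\<close>
  from \<open>0\<close>. Only \<open>\<gamma> = -\<rho>\<close> would cancel the main term.
\<close>

lemma resonant_integral_ge:
  fixes K \<rho> \<gamma> \<tau> \<delta> M :: real
  assumes K: "K \<ge> 1" "1 / K \<le> \<delta>" "\<delta> \<le> 1"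
    and \<tau>: "0 < \<tau>" "\<tau> \<le> \<rho>" "1 \<le> K * \<tau>"
    and \<gamma>: "\<gamma> = \<rho> \<or> \<bar>\<gamma>\<bar> \<le> \<rho> - \<tau>"
    and M: "\<bar>M - K * \<rho>\<bar> \<le> 1/2"
  shows "ln (\<delta> * K) / 2 - 6 * pi / \<tau> \<le>
    integral {1/K..\<delta>} (\<lambda>s. (sin (K * \<rho> * s) + sin (K * \<gamma> * s)) * (sin (M * s) / sin (s / 2)))"
proof -
  define I where "I \<omega> = cos_kernel_integral \<omega> (1/K) \<delta>" for \<omega>
  have pi3: "3 < pi" using pi_gt3 by simp
  have K\<tau>: "K * \<tau> \<le> K * \<rho>" using K \<tau> by (intro mult_left_mono) auto
  have small: "\<bar>I \<omega>\<bar> \<le> 4 * pi / \<tau>" if "\<bar>\<omega>\<bar> \<ge> K * \<tau> / 2" for \<omega>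
  proof -
    have K\<tau>0: "0 < K * \<tau> / 2" using K \<tau> by simp
    then have "\<bar>I \<omega>\<bar> \<le> 2 * pi / (\<bar>\<omega>\<bar> * (1 / K))"
      unfolding I_def using K that pi3 by (intro abs_cos_kernel_integral_le) auto
    also have "\<dots> \<le> 2 * pi / (K * \<tau> / 2 * (1 / K))"
      using K that K\<tau>0 by (intro divide_left_mono mult_right_mono mult_pos_pos) auto
    also have "\<dots> = 4 * pi / \<tau>" using K by (simp add: field_simps)
    finally show ?thesis .
  qed
  have large: "ln (\<delta> * K) \<le> I (K * \<rho> - M)"
    using cos_kernel_integral_ge_ln[of "1/K" \<delta> "K * \<rho> - M"] K M by (simp add: I_def abs_minus_commute)
  have a1: "I (K * \<rho> + M) \<le> 4 * pi / \<tau>"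
    using small[of "K * \<rho> + M"] M K\<tau> \<tau> by (auto simp: abs_if split: if_splits)
  have a2: "I (K * \<gamma> + M) \<le> 4 * pi / \<tau> \<and> - (4 * pi / \<tau>) \<le> I (K * \<gamma> - M) \<or>
     I (K * \<gamma> + M) \<le> 4 * pi / \<tau> \<and> 0 \<le> I (K * \<gamma> - M)"
  proof (cases "\<gamma> = \<rho>")
    case True
    have "1 \<le> \<delta> * K" using K by (simp add: field_simps)
    then have "0 \<le> ln (\<delta> * K)" by simp
    then show ?thesis using a1 large True by auto
  next
    case False
    then have "K * \<bar>\<gamma>\<bar> \<le> K * (\<rho> - \<tau>)" using \<gamma> K by (intro mult_left_mono) auto
    then have "\<bar>K * \<gamma>\<bar> \<le> K * \<rho> - K * \<tau>" using K by (simp add: abs_mult algebra_simps)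
    then have "\<bar>K * \<gamma> + M\<bar> \<ge> K * \<tau> / 2" "\<bar>K * \<gamma> - M\<bar> \<ge> K * \<tau> / 2"
      using M \<tau> by linarith+
    then show ?thesis using small[of "K * \<gamma> + M"] small[of "K * \<gamma> - M"] by auto
  qed
  have "((\<lambda>s. sin (K * \<rho> * s) * (sin (M * s) / sin (s / 2)) + sin (K * \<gamma> * s) * (sin (M * s) / sin (s / 2))) has_integral
    (I (K * \<rho> - M) - I (K * \<rho> + M)) / 2 + (I (K * \<gamma> - M) - I (K * \<gamma> + M)) / 2) {1/K..\<delta>}"
    unfolding I_def using K pi3 by (intro has_integral_add integral_sin_sin_div) auto
  then have "integral {1/K..\<delta>} (\<lambda>s. (sin (K * \<rho> * s) + sin (K * \<gamma> * s)) * (sin (M * s) / sin (s / 2)))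
     = (I (K * \<rho> - M) - I (K * \<rho> + M)) / 2 + (I (K * \<gamma> - M) - I (K * \<gamma> + M)) / 2"
    unfolding distrib_right[of "sin (K * \<rho> * _)"] by (rule integral_unique)
  moreover have "0 \<le> 4 * pi / \<tau>" using \<tau> by simp
  ultimately show ?thesis using large a1 a2 by (auto simp: field_simps)
qed

text \<open>
  Here \<open>\<beta>\<close> has the larger modulus. Its sign and that of \<open>n\<close> are pulled out as \<open>\<sigma>\<close>, and
  \<open>N\<close> is the integer part of \<open>\<bar>n\<beta>\<bar>\<close>, so that \<open>M = N + 1/2\<close> lies within \<open>1/2\<close> of the
  frequency. On \<open>[0, 1/\<bar>n\<bar>]\<close> the sines are at most \<open>\<bar>n\<beta>\<bar>s\<close> and the contribution is
  bounded.
\<close>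

lemma dirichlet_integral_ge_dominant:
  fixes \<beta> \<gamma> \<delta> :: real
  assumes le: "\<bar>\<gamma>\<bar> \<le> \<bar>\<beta>\<bar>" and ne: "\<beta> + \<gamma> \<noteq> 0" and \<delta>: "0 < \<delta>" "\<delta> \<le> 1"
  shows "\<exists>C k0. \<forall>n::int. real_of_int \<bar>n\<bar> \<ge> k0 \<longrightarrow> (\<exists>N. ln (real_of_int \<bar>n\<bar>) / 2 - C \<le>
    \<bar>integral {0..\<delta>} (\<lambda>s. (sin (n * \<beta> * s) + sin (n * \<gamma> * s)) * dirichlet_kernel N s)\<bar>)"
proof -
  have \<beta>0: "\<beta> \<noteq> 0" using le ne by auto
  define \<rho> where "\<rho> = \<bar>\<beta>\<bar>"
  define \<gamma>' where "\<gamma>' = sgn \<beta> * \<gamma>"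
  \<comment> \<open>The gap required by \<open>resonant_integral_ge\<close>.\<close>
  define \<tau> where "\<tau> = (if \<gamma>' = \<rho> then \<rho> else \<rho> - \<bar>\<gamma>'\<bar>)"
  have pi3: "3 < pi" using pi_gt3 by simp
  have \<gamma>'_le: "\<bar>\<gamma>'\<bar> \<le> \<rho>" using le \<beta>0 by (simp add: \<gamma>'_def \<rho>_def abs_mult abs_sgn_eq)
  have "\<gamma>' \<noteq> - \<rho>" using ne \<beta>0 by (auto simp: \<gamma>'_def \<rho>_def sgn_if)
  then have \<tau>: "0 < \<tau>" "\<tau> \<le> \<rho>" and \<gamma>\<tau>: "\<gamma>' = \<rho> \<or> \<bar>\<gamma>'\<bar> \<le> \<rho> - \<tau>"
    using \<gamma>'_le \<beta>0 by (auto simp: \<tau>_def \<rho>_def)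
  define C where "C = 6 * pi / \<tau> + 2 * pi * \<rho> - ln \<delta> / 2"
  define k0 where "k0 = max 1 (max (1 / \<delta>) (1 / \<tau>))"
  have "\<exists>N. ln (real_of_int \<bar>n\<bar>) / 2 - C \<le> \<bar>integral {0..\<delta>} (\<lambda>s. (sin (n * \<beta> * s) + sin (n * \<gamma> * s)) * dirichlet_kernel N s)\<bar>"
    if n: "real_of_int \<bar>n\<bar> \<ge> k0" for n :: int
  proof -
    define K where "K = real_of_int \<bar>n\<bar>"
    have K: "1 \<le> K" "1 / \<delta> \<le> K" "1 / \<tau> \<le> K" using n by (auto simp: K_def k0_def)
    have K': "1 / K \<le> \<delta>" "1 \<le> K * \<tau>" "0 < K" using K \<delta> \<tau> by (auto simp: field_simps)
    define N where "N = nat \<lfloor>K * \<rho>\<rfloor>"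
    define M where "M = real N + 1/2"
    have M: "\<bar>M - K * \<rho>\<bar> \<le> 1/2"
    proof -
      have "0 \<le> K * \<rho>" using K by (simp add: \<rho>_def)
      then have "real N = of_int \<lfloor>K * \<rho>\<rfloor>" by (simp add: N_def)
      then show ?thesis
        using of_int_floor_le[of "K * \<rho>"] real_of_int_floor_add_one_gt[of "K * \<rho>"]
        unfolding M_def by linarith
    qed
    define \<sigma> where "\<sigma> = sgn (n * \<beta>)"
    have \<sigma>: "\<sigma> = 1 \<or> \<sigma> = -1" using K \<beta>0 by (auto simp: \<sigma>_def K_def sgn_if)
    have "K * \<rho> = \<sigma> * (n * \<beta>)" "K * \<gamma>' = \<sigma> * (n * \<gamma>)"
      unfolding K_def \<rho>_def \<gamma>'_def \<sigma>_def of_int_abs sgn_mult abs_sgn[of "real_of_int n"] abs_sgn[of \<beta>]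
      by (simp_all add: mult_ac)
    then have phase: "sin (n * \<beta> * s) + sin (n * \<gamma> * s) = \<sigma> * (sin (K * \<rho> * s) + sin (K * \<gamma>' * s))" for s
      using \<sigma> by (auto simp: mult.assoc)
    define g where "g s = (sin (K * \<rho> * s) + sin (K * \<gamma>' * s)) * dirichlet_kernel N s" for s
    have g_cont: "continuous_on A g" for A
      unfolding g_def by (intro continuous_intros)
    have "norm (integral {0..1/K} g) \<le> (2 * pi * (K * \<rho>)) * (1/K - 0)"
    proof (rule integral_bound[OF _ g_cont])
      fix s assume s: "s \<in> {0..1/K}"
      show "norm (g s) \<le> 2 * pi * (K * \<rho>)"
      proof (cases "s = 0")
        case True
        then show ?thesis using K by (simp add: g_def \<rho>_def)
      next
        case False
        then have s': "0 < s" "s \<le> pi" using s K'(1) \<delta> pi3 by auto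
        have "\<bar>sin (K * \<rho> * s)\<bar> \<le> \<bar>K * \<rho> * s\<bar>" "\<bar>sin (K * \<gamma>' * s)\<bar> \<le> \<bar>K * \<gamma>' * s\<bar>"
          by (rule abs_sin_x_le_abs_x)+
        moreover have "\<bar>K * \<gamma>' * s\<bar> \<le> K * \<rho> * s" "\<bar>K * \<rho> * s\<bar> = K * \<rho> * s"
          using s' K' \<gamma>'_le by (auto simp: abs_mult \<rho>_def)
        ultimately have "\<bar>sin (K * \<rho> * s) + sin (K * \<gamma>' * s)\<bar> \<le> 2 * (K * \<rho> * s)"
          by linarith
        then have "norm (g s) \<le> (2 * (K * \<rho> * s)) * (pi / s)"
          unfolding g_def real_norm_def abs_mult[of _ "dirichlet_kernel N s"]
          using abs_dirichlet_kernel_le[OF s', of N] by (intro mult_mono) auto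
        then show ?thesis using s' by (simp add: field_simps)
      qed
    qed (use K in auto)
    then have near: "\<bar>integral {0..1/K} g\<bar> \<le> 2 * pi * \<rho>" using K' by simp
    have "ln (\<delta> * K) / 2 - 6 * pi / \<tau> \<le>
      integral {1/K..\<delta>} (\<lambda>s. (sin (K * \<rho> * s) + sin (K * \<gamma>' * s)) * (sin (M * s) / sin (s / 2)))"
      by (rule resonant_integral_ge[OF K(1) K'(1) \<delta>(2) \<tau> K'(2) \<gamma>\<tau> M])
    also have "\<dots> = integral {1/K..\<delta>} g"
    proof (rule integral_cong)
      fix s assume "s \<in> {1/K..\<delta>}"
      then have "0 < s" using K' by (auto intro: less_le_trans[of 0 "1/K"])
      moreover have "s \<le> pi" using \<open>s \<in> {1/K..\<delta>}\<close> \<delta> pi3 by auto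
      ultimately show "(sin (K * \<rho> * s) + sin (K * \<gamma>' * s)) * (sin (M * s) / sin (s / 2)) = g s"
        by (simp add: g_def dirichlet_kernel_eq M_def)
    qed
    also have "\<dots> = integral {0..\<delta>} g - integral {0..1/K} g"
      using Henstock_Kurzweil_Integration.integral_combine[of 0 "1/K" \<delta> g] K K'
      by (simp add: integrable_continuous_real[OF g_cont])
    finally have "ln (\<delta> * K) / 2 - 6 * pi / \<tau> - 2 * pi * \<rho> \<le> integral {0..\<delta>} g"
      using near by linarith
    moreover have "ln (\<delta> * K) = ln \<delta> + ln K" using \<delta> K' by (simp add: ln_mult)
    moreover have "\<bar>integral {0..\<delta>} (\<lambda>s. (sin (n * \<beta> * s) + sin (n * \<gamma> * s)) * dirichlet_kernel N s)\<bar> = \<bar>integral {0..\<delta>} g\<bar>"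
      unfolding phase mult.assoc[of \<sigma>] g_def[symmetric] using \<sigma> by (auto simp: abs_mult)
    ultimately have "ln (real_of_int \<bar>n\<bar>) / 2 - C \<le> \<bar>integral {0..\<delta>} (\<lambda>s. (sin (n * \<beta> * s) + sin (n * \<gamma> * s)) * dirichlet_kernel N s)\<bar>"
      unfolding C_def K_def by linarith
    then show ?thesis by blast
  qed
  then show ?thesis by blast
qed

lemma dirichlet_integral_ge:
  fixes \<beta> \<gamma> \<delta> :: real
  assumes ne: "\<beta> + \<gamma> \<noteq> 0" and \<delta>: "0 < \<delta>" "\<delta> \<le> 1"
  shows "\<exists>C k0. \<forall>n::int. real_of_int \<bar>n\<bar> \<ge> k0 \<longrightarrow> (\<exists>N. ln (real_of_int \<bar>n\<bar>) / 2 - C \<le>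
    \<bar>integral {0..\<delta>} (\<lambda>s. (sin (n * \<beta> * s) + sin (n * \<gamma> * s)) * dirichlet_kernel N s)\<bar>)"
proof (cases "\<bar>\<gamma>\<bar> \<le> \<bar>\<beta>\<bar>")
  case True
  then show ?thesis by (rule dirichlet_integral_ge_dominant[OF _ ne \<delta>])
next
  case False
  then show ?thesis
    using dirichlet_integral_ge_dominant[of \<beta> \<gamma> \<delta>] ne \<delta> by (simp add: add.commute)
qed

section \<open>Exponentials of piecewise linear circle maps\<close>

lemma norm_exp_ii_of_real: "norm (exp (\<i> * of_int n * of_real x)) = 1"
  using norm_exp_i_times[of "n * x"] by (simp add: mult.assoc)

lemma exp_circle_map_in_circle_C:
  assumes "circle_map \<phi>"
  shows "(\<lambda>t. exp (\<i> * of_int n * of_real (\<phi> t))) \<in> circle_C"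
proof -
  obtain m :: int where m: "\<And>t. \<phi> (t + 2 * pi) = \<phi> t + 2 * pi * m"
    using circle_map_degree[OF assms] by blast
  have "exp (\<i> * of_int n * of_real (\<phi> (t + 2 * pi))) = exp (\<i> * of_int n * of_real (\<phi> t))" for t
    unfolding exp_eq m by (intro exI[of _ "n * m"]) (simp add: algebra_simps)
  moreover have "continuous_on UNIV (\<lambda>t. exp (\<i> * of_int n * of_real (\<phi> t)))"
    using assms by (intro continuous_intros) (auto simp: circle_map_def)
  ultimately show ?thesis by (simp add: circle_C_def)
qed

lemma exp_lipschitz:
  fixes n :: int
  assumes "A-lipschitz_on UNIV \<phi>"
  shows "(real_of_int \<bar>n\<bar> * A)-lipschitz_on UNIV (\<lambda>t. exp (\<i> * of_int n * of_real (\<phi> t)))"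
proof (rule lipschitz_onI)
  fix x y
  define d where "d = n * (\<phi> x - \<phi> y)"
  have "exp (\<i> * of_int n * of_real (\<phi> x)) - exp (\<i> * of_int n * of_real (\<phi> y))
     = exp (\<i> * of_int n * of_real (\<phi> y)) * (exp (\<i> * of_real d) - 1)"
    by (simp add: d_def right_diff_distrib exp_add[symmetric] algebra_simps)
  then have "dist (exp (\<i> * of_int n * of_real (\<phi> x))) (exp (\<i> * of_int n * of_real (\<phi> y))) = 2 * \<bar>sin (d / 2)\<bar>"
    by (simp add: dist_norm norm_mult norm_exp_ii_of_real dist_exp_i_1)
  also have "\<dots> \<le> \<bar>d\<bar>" using abs_sin_x_le_abs_x[of "d / 2"] by simp
  also have "\<bar>d\<bar> = real_of_int \<bar>n\<bar> * dist (\<phi> x) (\<phi> y)" by (simp add: d_def abs_mult dist_real_def)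
  also have "\<dots> \<le> real_of_int \<bar>n\<bar> * (A * dist x y)"
    using lipschitz_onD[OF assms, of x y] by (intro mult_left_mono) auto
  finally show "dist (exp (\<i> * of_int n * of_real (\<phi> x))) (exp (\<i> * of_int n * of_real (\<phi> y))) \<le> real_of_int \<bar>n\<bar> * A * dist x y"
    by simp
qed (use lipschitz_on_nonneg[OF assms] in simp)

lemma norm_fourier_sum_exp_le:
  fixes n :: int
  assumes cm: "circle_map \<phi>" and A: "A-lipschitz_on UNIV \<phi>" and n: "n \<noteq> 0"
  shows "norm (fourier_sum N (\<lambda>t. exp (\<i> * of_int n * of_real (\<phi> t))) t) \<le> 1 + A + 2 * ln pi + 2 * ln (real_of_int \<bar>n\<bar>)"
proof -
  define f where "f = (\<lambda>t. exp (\<i> * of_int n * of_real (\<phi> t)))"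
  define \<eta> where "\<eta> = 1 / real_of_int \<bar>n\<bar>"
  have n1: "real_of_int \<bar>n\<bar> \<ge> 1" using n by linarith
  then have "0 < \<eta>" "\<eta> \<le> 1" by (simp_all add: \<eta>_def)
  then have \<eta>: "0 < \<eta>" "\<eta> \<le> pi" using pi_gt3 by linarith+
  have "norm (fourier_sum N f t - f t) \<le> real_of_int \<bar>n\<bar> * A * \<eta> + 2 * ln (pi / \<eta>)"
    unfolding f_def
    by (rule norm_fourier_sum_minus_le[OF exp_circle_map_in_circle_C[OF cm] exp_lipschitz[OF A] _ \<eta>])
      (simp add: norm_exp_ii_of_real)
  also have "real_of_int \<bar>n\<bar> * A * \<eta> = A" using n by (simp add: \<eta>_def)
  also have "ln (pi / \<eta>) = ln pi + ln (real_of_int \<bar>n\<bar>)" using n1 by (simp add: \<eta>_def ln_mult)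
  finally have "norm (fourier_sum N f t - f t) \<le> A + 2 * (ln pi + ln (real_of_int \<bar>n\<bar>))" .
  moreover have "norm (f t) = 1" by (simp add: f_def norm_exp_ii_of_real)
  ultimately show ?thesis
    using norm_triangle_sub[of "fourier_sum N f t" "f t"] by (simp add: f_def)
qed

text \<open>
  Evaluates the partial sums at a corner \<open>t0\<close>. On \<open>[0, \<delta>]\<close> both branches are pure exponentials
  times \<open>f(t0)\<close>; beyond \<open>\<delta>\<close> the kernel is bounded independently of \<open>N\<close>. Only the imaginary part is
  kept: the real part involves \<open>cos(n\<beta>s) sin(Ms)\<close>, which has no resonant cosine.
\<close>

lemma exists_fourier_sum_exp_ge:
  assumes cm: "circle_map \<phi>" and pl: "piecewise_linear \<phi>" and na: "\<not> affine_linear_on UNIV \<phi>"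
  shows "\<exists>C k0. \<forall>n::int. real_of_int \<bar>n\<bar> \<ge> k0 \<longrightarrow> (\<exists>N t. ln (real_of_int \<bar>n\<bar>) / 2 - C \<le>
     2 * pi * norm (fourier_sum N (\<lambda>t. exp (\<i> * of_int n * of_real (\<phi> t))) t))"
proof -
  obtain \<delta>' \<beta> \<gamma> t0 where \<delta>': "\<delta>' > 0" and ne: "\<beta> + \<gamma> \<noteq> 0" 
    and right': "\<And>s. s \<in> {0..\<delta>'} \<Longrightarrow> \<phi> (t0 + s) = \<phi> t0 + \<beta> * s"
    and left': "\<And>s. s \<in> {0..\<delta>'} \<Longrightarrow> \<phi> (t0 - s) = \<phi> t0 + \<gamma> * s"
    by (rule exists_corner[OF cm pl na]; rule that; assumption)
  define \<delta> where "\<delta> = min 1 \<delta>'"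
  have \<delta>: "0 < \<delta>" "\<delta> \<le> 1" "\<delta> \<le> pi" using \<delta>' pi_gt3 by (auto simp: \<delta>_def)
  have right: "\<phi> (t0 + s) = \<phi> t0 + \<beta> * s" and left: "\<phi> (t0 - s) = \<phi> t0 + \<gamma> * s" if "s \<in> {0..\<delta>}" for s
    using right' left' that by (auto simp: \<delta>_def)
  obtain C k0 where Ck: "\<And>n::int. real_of_int \<bar>n\<bar> \<ge> k0 \<Longrightarrow> \<exists>N. ln (real_of_int \<bar>n\<bar>) / 2 - C \<le>
    \<bar>integral {0..\<delta>} (\<lambda>s. (sin (n * \<beta> * s) + sin (n * \<gamma> * s)) * dirichlet_kernel N s)\<bar>"
    using dirichlet_integral_ge[OF ne \<delta>(1,2)] by blast
  have "\<exists>N t. ln (real_of_int \<bar>n\<bar>) / 2 - (C + 2 * pi / \<delta> * (pi - \<delta>)) \<le>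
     2 * pi * norm (fourier_sum N (\<lambda>t. exp (\<i> * of_int n * of_real (\<phi> t))) t)"
    if n: "real_of_int \<bar>n\<bar> \<ge> k0" for n :: int
  proof -
    define f where "f = (\<lambda>t. exp (\<i> * of_int n * of_real (\<phi> t)))"
    have f: "f \<in> circle_C" unfolding f_def by (rule exp_circle_map_in_circle_C[OF cm])
    have norm_f: "norm (f t) = 1" for t by (simp add: f_def norm_exp_ii_of_real)
    obtain N where N: "ln (real_of_int \<bar>n\<bar>) / 2 - C \<le>
       \<bar>integral {0..\<delta>} (\<lambda>s. (sin (n * \<beta> * s) + sin (n * \<gamma> * s)) * dirichlet_kernel N s)\<bar>"
      using Ck[OF n] by blast
    define g where "g s = (f (t0 + s) + f (t0 - s)) * of_real (dirichlet_kernel N s)" for s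
    define e where "e s = (exp (\<i> * of_real (n * \<beta> * s)) + exp (\<i> * of_real (n * \<gamma> * s))) * complex_of_real (dirichlet_kernel N s)" for s
    have e_int: "e integrable_on {0..\<delta>}"
      unfolding e_def by (intro integrable_continuous_real continuous_intros)
    have g_int: "g integrable_on {a..b}" for a b
      unfolding g_def by (intro integrable_continuous_real continuous_intros circle_C_continuous_on[OF f])
    have "integral {0..\<delta>} g = integral {0..\<delta>} (\<lambda>s. f t0 * e s)"
    proof (rule integral_cong)
      fix s assume s: "s \<in> {0..\<delta>}"
      have "f (t0 + s) = f t0 * exp (\<i> * of_real (n * \<beta> * s))"
        using right[OF s] by (simp add: f_def exp_add[symmetric] algebra_simps)
      moreover have "f (t0 - s) = f t0 * exp (\<i> * of_real (n * \<gamma> * s))"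
        using left[OF s] by (simp add: f_def exp_add[symmetric] algebra_simps)
      ultimately show "g s = f t0 * e s" 
        unfolding g_def e_def by (simp only: distrib_left[symmetric] mult.assoc[of "f t0"])
    qed
    also have "\<dots> = f t0 * integral {0..\<delta>} e" by (rule Henstock_Kurzweil_Integration.integral_mult_right)
    finally have "norm (integral {0..\<delta>} g) = norm (integral {0..\<delta>} e)" by (simp add: norm_mult norm_f)
    moreover have "integral {0..\<delta>} (\<lambda>s. (sin (n * \<beta> * s) + sin (n * \<gamma> * s)) * dirichlet_kernel N s) = Im (integral {0..\<delta>} e)"
    proof -
      have "integral {0..\<delta>} (Im \<circ> e) = Im (integral {0..\<delta>} e)"
        by (rule integral_linear[OF e_int bounded_linear_Im])
      moreover have "Im \<circ> e = (\<lambda>s. (sin (n * \<beta> * s) + sin (n * \<gamma> * s)) * dirichlet_kernel N s)"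
        by (auto simp: e_def fun_eq_iff Im_exp)
      ultimately show ?thesis by simp
    qed
    ultimately have near: "ln (real_of_int \<bar>n\<bar>) / 2 - C \<le> norm (integral {0..\<delta>} g)"
      using N abs_Im_le_cmod[of "integral {0..\<delta>} e"] by linarith
    have far: "norm (integral {\<delta>..pi} g) \<le> 2 * pi / \<delta> * (pi - \<delta>)"
    proof (rule integral_bound[OF \<delta>(3)])
      show "continuous_on {\<delta>..pi} g"
        unfolding g_def by (intro continuous_intros circle_C_continuous_on[OF f])
      fix s assume "s \<in> {\<delta>..pi}"
      then have s: "0 < s" "s \<le> pi" "\<delta> \<le> s" using \<delta> by auto
      have "pi / s \<le> pi / \<delta>" using s \<delta> by (intro divide_left_mono) auto
      then have D: "\<bar>dirichlet_kernel N s\<bar> \<le> pi / \<delta>" using abs_dirichlet_kernel_le[OF s(1,2), of N] by linarith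
      have "norm (f (t0 + s) + f (t0 - s)) \<le> 2"
        using norm_triangle_ineq[of "f (t0 + s)" "f (t0 - s)"] by (simp add: norm_f)
      then have "norm (g s) \<le> 2 * (pi / \<delta>)"
        unfolding g_def norm_mult norm_of_real using D by (intro mult_mono) auto
      then show "norm (g s) \<le> 2 * pi / \<delta>" by simp
    qed
    have "integral {0..\<delta>} g + integral {\<delta>..pi} g = integral {0..pi} g"
      using \<delta> by (intro Henstock_Kurzweil_Integration.integral_combine g_int) auto
    also have "\<dots> = 2 * pi * fourier_sum N f t0"
      unfolding fourier_sum_eq_integral[OF f] g_def[abs_def] by simp
    finally have "norm (2 * pi * fourier_sum N f t0) = norm (integral {0..\<delta>} g + integral {\<delta>..pi} g)" by simp
    then have "2 * pi * norm (fourier_sum N f t0) \<ge> norm (integral {0..\<delta>} g) - norm (integral {\<delta>..pi} g)"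
      using norm_diff_ineq[of "integral {0..\<delta>} g" "integral {\<delta>..pi} g"] by (simp add: norm_mult)
    then have "ln (real_of_int \<bar>n\<bar>) / 2 - (C + 2 * pi / \<delta> * (pi - \<delta>)) \<le> 2 * pi * norm (fourier_sum N f t0)"
      using near far by linarith
    then show ?thesis unfolding f_def by blast
  qed
  then show ?thesis by blast
qed

theorem mainTheorem1:
  fixes \<phi> :: "real \<Rightarrow> real"
  assumes "circle_map \<phi>"
    and "piecewise_linear \<phi>"
    and "\<not> affine_linear_on UNIV \<phi>"
  shows "\<exists>c1 c2 :: real. \<exists>n0 :: int. 0 < c1 \<and> c1 \<le> c2 \<and> n0 \<ge> 2 \<and>
    (\<forall>n :: int. \<bar>n\<bar> \<ge> n0 \<longrightarrow>
       (\<lambda>t. exp (\<i> * of_int n * of_real (\<phi> t))) \<in> circle_U \<and>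
       c1 * ln (real_of_int \<bar>n\<bar>) \<le> U_norm (\<lambda>t. exp (\<i> * of_int n * of_real (\<phi> t))) \<and>
       U_norm (\<lambda>t. exp (\<i> * of_int n * of_real (\<phi> t))) \<le> c2 * ln (real_of_int \<bar>n\<bar>))"
proof -
  obtain A where A: "A-lipschitz_on UNIV \<phi>"
    using piecewise_linear_lipschitz[OF assms(1,2)] by blast
  obtain C k0 where Ck: "\<And>n::int. real_of_int \<bar>n\<bar> \<ge> k0 \<Longrightarrow> \<exists>N t. ln (real_of_int \<bar>n\<bar>) / 2 - C \<le>
     2 * pi * norm (fourier_sum N (\<lambda>t. exp (\<i> * of_int n * of_real (\<phi> t))) t)"
    using exists_fourier_sum_exp_ge[OF assms] by blast
  define c1 where "c1 = 1 / (8 * pi)"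
  define c2 where "c2 = 3 + A + 2 * ln pi"
  \<comment> \<open>If \<open>4C \<le> ln \<bar>n\<bar>\<close>, then \<open>C\<close> uses up at most half of \<open>(ln \<bar>n\<bar>)/2\<close>; \<open>\<bar>n\<bar> \<ge> 3 > e\<close> absorbs constants into the logarithm.\<close>
  define n0 where "n0 = max 3 (max \<lceil>k0\<rceil> \<lceil>exp (4 * C)\<rceil>)"
  have A0: "A \<ge> 0" by (rule lipschitz_on_nonneg[OF A])
  have lnpi: "ln pi \<ge> 0" using pi_gt3 by simp
  have "c1 \<le> 1" using pi_gt3 by (simp add: c1_def)
  then have c2: "c1 \<le> c2" using A0 lnpi unfolding c2_def by linarith
  have c1: "0 < c1" by (simp add: c1_def)
  have "(\<lambda>t. exp (\<i> * of_int n * of_real (\<phi> t))) \<in> circle_U \<and>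
       c1 * ln (real_of_int \<bar>n\<bar>) \<le> U_norm (\<lambda>t. exp (\<i> * of_int n * of_real (\<phi> t))) \<and>
       U_norm (\<lambda>t. exp (\<i> * of_int n * of_real (\<phi> t))) \<le> c2 * ln (real_of_int \<bar>n\<bar>)"
    if n: "\<bar>n\<bar> \<ge> n0" for n :: int
  proof -
    define f where "f = (\<lambda>t. exp (\<i> * of_int n * of_real (\<phi> t)))"
    have n': "real_of_int \<bar>n\<bar> \<ge> 3" "real_of_int \<bar>n\<bar> \<ge> k0" "real_of_int \<bar>n\<bar> \<ge> exp (4 * C)"
      using n by (auto simp: n0_def ceiling_le_iff)
    have "exp 1 \<le> real_of_int \<bar>n\<bar>" using n'(1) exp_le by linarith
    then have ln1: "1 \<le> ln (real_of_int \<bar>n\<bar>)" using n'(1) by (subst ln_ge_iff) auto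
    have lnC: "4 * C \<le> ln (real_of_int \<bar>n\<bar>)" using n' by (subst ln_ge_iff) auto
    have U: "f \<in> circle_U"
      unfolding f_def using exp_circle_map_in_circle_C[OF assms(1)] exp_lipschitz[OF A]
      by (rule lipschitz_in_circle_U) (simp add: norm_exp_ii_of_real)
    have bd: "norm (fourier_sum N f t) \<le> 1 + A + 2 * ln pi + 2 * ln (real_of_int \<bar>n\<bar>)" for N t
      unfolding f_def using n'(1) by (intro norm_fourier_sum_exp_le assms A) auto
    have "U_norm f \<le> 1 + A + 2 * ln pi + 2 * ln (real_of_int \<bar>n\<bar>)"
      by (rule U_norm_bounds(1)[OF bd])
    also have "\<dots> \<le> c2 * ln (real_of_int \<bar>n\<bar>)"
      using mult_left_mono[OF ln1, of "1 + A + 2 * ln pi"] A0 lnpi by (simp add: c2_def algebra_simps)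
    finally have upper: "U_norm f \<le> c2 * ln (real_of_int \<bar>n\<bar>)" .
    have lower: "c1 * ln (real_of_int \<bar>n\<bar>) \<le> U_norm f"
    proof -
      obtain N t where "ln (real_of_int \<bar>n\<bar>) / 2 - C \<le> 2 * pi * norm (fourier_sum N f t)"
        using Ck[OF n'(2)] unfolding f_def by blast
      also have "\<dots> \<le> 2 * pi * U_norm f"
        by (intro mult_left_mono U_norm_bounds(2)[OF bd]) auto
      finally have "ln (real_of_int \<bar>n\<bar>) / 4 \<le> 2 * pi * U_norm f" using lnC by linarith
      then show ?thesis by (simp add: c1_def field_simps)
    qed
    show ?thesis using U lower upper unfolding f_def by blast
  qed
  moreover have "n0 \<ge> 2" by (simp add: n0_def)
  ultimately show ?thesis using c1 c2 by blast
qed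

end
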